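(* Let $G$ be a unique product group and suppose $S$ is a strongly $G$-graded ring with $R=S_e$. Let $M$ be a right $R$-module. Then $$\operatorname{Ass}(M\otimes_R S)=\{\,(J:G)S \mid J \text{ is the annihilator in } R \text{ of an } S\text{-prime submodule of } M\,\}.$$ If $R$ satisfies the ascending chain condition on (two-sided) ideals, then $\operatorname{Ass}(M\otimes_R S)=\{\,(J:G)S\mid J\in\operatorname{Ass} M\,\}$.
   Context: Rings have $1$, modules are unital right modules, ideals are two-sided. A unique product group is a group $G$ (identity $e$) such that whenever $X,Y$ are nonempty finite subsets of $G$, there exist $x\in X$, $y\in Y$ with $xy\ne x'y'$ for every pair $(x',y')\in X\times Y$ different from $(x,y)$. A $G$-graded ring is a ring $S=\bigoplus_{g\in G}S_g$ with $S_gS_h\subseteq S_{gh}$ and $1\in S_e$; it is strongly graded if $S_gS_h=S_{gh}$ for all $g,h\in G$. For an ideal $I$ of $R$ and $g\in G$, $I^g=S_gIS_{g^{-1}}$, and $(I:G)=\bigcap_{g\in G}I^g$. A nonzero module is prime if all its nonzero submodules have the same annihilator as the module itself. $\operatorname{Ass}$ of a module is the set of annihilators of its prime submodules (over the ring in question). A right $R$-module $L$ is $S$-prime if $L\otimes_R S$ is a prime right $S$-module. *)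

theory Defs
  imports "HOL-Algebra.Free_Abelian_Groups" "HOL-Algebra.Generated_Groups" "HOL-Algebra.Ideal_Product"
begin

section \<open>Unique product groups\<close>

locale unique_product_group = group G for G (structure) +
  assumes unique_product:
    "\<lbrakk>finite X; X \<noteq> {}; X \<subseteq> carrier G; finite Y; Y \<noteq> {}; Y \<subseteq> carrier G\<rbrakk> \<Longrightarrow>
     \<exists>x\<in>X. \<exists>y\<in>Y. \<forall>x'\<in>X. \<forall>y'\<in>Y. (x', y') \<noteq> (x, y) \<longrightarrow> x \<otimes> y \<noteq> x' \<otimes> y'"

section \<open>Graded rings\<close>

text \<open>
  Although \<^const>\<open>ideal_prod\<close> is meant for ideals in the library, for arbitrary additive
  subgroups \<open>A\<close> and \<open>B\<close> it yields the additive subgroup \<open>AB\<close> of finite sums of products \<open>ab\<close>;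
  all products of subsets of \<open>S\<close> below are taken in this sense.
\<close>

text \<open>The family \<open>D\<close> assigns to each group element \<open>g\<close> the homogeneous component \<open>S\<^sub>g\<close>.\<close>

locale graded_ring = G?: group G + S?: ring S
  for G (structure) and S (structure) and D +
  assumes component_subgroup: "g \<in> carrier G \<Longrightarrow> additive_subgroup (D g) S"
    and direct_sum:
      "s \<in> carrier S \<Longrightarrow>
       \<exists>!f. f \<in> (\<Pi>\<^sub>E g\<in>carrier G. D g) \<and> finite {g \<in> carrier G. f g \<noteq> \<zero>\<^bsub>S\<^esub>} \<and>
            s = finsum S f {g \<in> carrier G. f g \<noteq> \<zero>\<^bsub>S\<^esub>}"
    and component_mult:
      "\<lbrakk>g \<in> carrier G; h \<in> carrier G\<rbrakk> \<Longrightarrow> D g \<cdot>\<^bsub>S\<^esub> D h \<subseteq> D (g \<otimes>\<^bsub>G\<^esub> h)"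
    and one_component: "\<one>\<^bsub>S\<^esub> \<in> D \<one>\<^bsub>G\<^esub>"

locale strongly_graded_ring = graded_ring +
  assumes strong:
    "\<lbrakk>g \<in> carrier G; h \<in> carrier G\<rbrakk> \<Longrightarrow> D g \<cdot>\<^bsub>S\<^esub> D h = D (g \<otimes>\<^bsub>G\<^esub> h)"

definition base_ring ::
    "('g, 'x) monoid_scheme \<Rightarrow> ('s, 'y) ring_scheme \<Rightarrow> ('g \<Rightarrow> 's set) \<Rightarrow> ('s, 'y) ring_scheme"
  where "base_ring G S D = S\<lparr>carrier := D \<one>\<^bsub>G\<^esub>\<rparr>"

text \<open>The ideals \<open>I\<^sup>g\<close> and \<open>(I : G)\<close> for an ideal \<open>I\<close> of the base ring \<open>R\<close>.\<close>

definition conj_ideal ::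
    "('g, 'x) monoid_scheme \<Rightarrow> ('s, 'y) ring_scheme \<Rightarrow> ('g \<Rightarrow> 's set) \<Rightarrow> 's set \<Rightarrow> 'g \<Rightarrow> 's set"
  where "conj_ideal G S D I g = (D g \<cdot>\<^bsub>S\<^esub> I) \<cdot>\<^bsub>S\<^esub> D (inv\<^bsub>G\<^esub> g)"

definition core_ideal ::
    "('g, 'x) monoid_scheme \<Rightarrow> ('s, 'y) ring_scheme \<Rightarrow> ('g \<Rightarrow> 's set) \<Rightarrow> 's set \<Rightarrow> 's set"
  where "core_ideal G S D I = (\<Inter>g\<in>carrier G. conj_ideal G S D I g)"

definition acc_on_ideals :: "('a, 'b) ring_scheme \<Rightarrow> bool"
  where "acc_on_ideals R \<longleftrightarrow>
    (\<forall>I :: nat \<Rightarrow> 'a set. (\<forall>n. ideal (I n) R \<and> I n \<subseteq> I (Suc n)) \<longrightarrow> (\<exists>n. \<forall>m\<ge>n. I m = I n))"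

section \<open>Right modules\<close>

text \<open>
  As for the library's left modules over commutative rings, the fields \<^const>\<open>mult\<close> and
  \<^const>\<open>one\<close> inherited from \<^type>\<open>ring_ext\<close> carry no meaning.
\<close>

record ('a, 'b) right_module = "'b ring" +
  rsmult :: "['b, 'a] \<Rightarrow> 'b" (infixl \<open>\<bullet>\<index>\<close> 70)

locale right_module = A?: ring A + M?: abelian_group M
  for A (structure) and M :: "('a, 'm, 'z) right_module_scheme" (structure) +
  assumes rsmult_closed:
      "\<lbrakk>x \<in> carrier M; a \<in> carrier A\<rbrakk> \<Longrightarrow> x \<bullet>\<^bsub>M\<^esub> a \<in> carrier M"
    and rsmult_l_distr:
      "\<lbrakk>x \<in> carrier M; y \<in> carrier M; a \<in> carrier A\<rbrakk> \<Longrightarrow>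
       (x \<oplus>\<^bsub>M\<^esub> y) \<bullet>\<^bsub>M\<^esub> a = (x \<bullet>\<^bsub>M\<^esub> a) \<oplus>\<^bsub>M\<^esub> (y \<bullet>\<^bsub>M\<^esub> a)"
    and rsmult_r_distr:
      "\<lbrakk>x \<in> carrier M; a \<in> carrier A; b \<in> carrier A\<rbrakk> \<Longrightarrow>
       x \<bullet>\<^bsub>M\<^esub> (a \<oplus>\<^bsub>A\<^esub> b) = (x \<bullet>\<^bsub>M\<^esub> a) \<oplus>\<^bsub>M\<^esub> (x \<bullet>\<^bsub>M\<^esub> b)"
    and rsmult_assoc:
      "\<lbrakk>x \<in> carrier M; a \<in> carrier A; b \<in> carrier A\<rbrakk> \<Longrightarrow>
       x \<bullet>\<^bsub>M\<^esub> (a \<otimes>\<^bsub>A\<^esub> b) = (x \<bullet>\<^bsub>M\<^esub> a) \<bullet>\<^bsub>M\<^esub> b"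
    and rsmult_one:
      "x \<in> carrier M \<Longrightarrow> x \<bullet>\<^bsub>M\<^esub> \<one>\<^bsub>A\<^esub> = x"

locale right_submodule = additive_subgroup N M
  for N and A :: "('a, 'x) ring_scheme" and M :: "('a, 'm, 'z) right_module_scheme" (structure) +
  assumes rsmult_mem: "\<lbrakk>x \<in> N; a \<in> carrier A\<rbrakk> \<Longrightarrow> x \<bullet>\<^bsub>M\<^esub> a \<in> N"

definition annihilator ::
    "('a, 'x) ring_scheme \<Rightarrow> ('a, 'm, 'z) right_module_scheme \<Rightarrow> 'a set"
  where "annihilator A M = {a \<in> carrier A. \<forall>x\<in>carrier M. x \<bullet>\<^bsub>M\<^esub> a = \<zero>\<^bsub>M\<^esub>}"

locale prime_right_module = right_module +
  assumes nonzero: "carrier M \<noteq> {\<zero>\<^bsub>M\<^esub>}"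
    and annihilator_eq:
      "\<lbrakk>right_submodule N A M; N \<noteq> {\<zero>\<^bsub>M\<^esub>}\<rbrakk> \<Longrightarrow>
       annihilator A (M\<lparr>carrier := N\<rparr>) = annihilator A M"

definition Ass ::
    "('a, 'x) ring_scheme \<Rightarrow> ('a, 'm, 'z) right_module_scheme \<Rightarrow> 'a set set"
  where "Ass A M =
    {annihilator A (M\<lparr>carrier := N\<rparr>) | N.
       right_submodule N A M \<and> prime_right_module A (M\<lparr>carrier := N\<rparr>)}"

section \<open>The tensor product with an overring\<close>

text \<open>
  Let \<open>R\<close> be a subring of \<open>S\<close> and \<open>M\<close> a right \<open>R\<close>-module. The right \<open>S\<close>-module
  \<open>M \<otimes>\<^sub>R S\<close> is the free abelian group on the pairs \<open>(x, s)\<close> modulo the subgroup generated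
  by the usual relations; \<open>t \<in> S\<close> acts by \<open>(x \<otimes> s) t = x \<otimes> s t\<close>.
\<close>

definition tensor_relations ::
    "('s, 'x) ring_scheme \<Rightarrow> ('s, 'm, 'z) right_module_scheme \<Rightarrow> ('s, 'y) ring_scheme \<Rightarrow>
     ('m \<times> 's \<Rightarrow>\<^sub>0 int) set"
  where "tensor_relations R M S =
    {frag_of (x \<oplus>\<^bsub>M\<^esub> y, s) - frag_of (x, s) - frag_of (y, s) | x y s.
       x \<in> carrier M \<and> y \<in> carrier M \<and> s \<in> carrier S} \<union>
    {frag_of (x, s \<oplus>\<^bsub>S\<^esub> t) - frag_of (x, s) - frag_of (x, t) | x s t.
       x \<in> carrier M \<and> s \<in> carrier S \<and> t \<in> carrier S} \<union>
    {frag_of (x \<bullet>\<^bsub>M\<^esub> r, s) - frag_of (x, r \<otimes>\<^bsub>S\<^esub> s) | x r s.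
       x \<in> carrier M \<and> r \<in> carrier R \<and> s \<in> carrier S}"

definition tensor_free ::
    "('s, 'm, 'z) right_module_scheme \<Rightarrow> ('s, 'y) ring_scheme \<Rightarrow> ('m \<times> 's \<Rightarrow>\<^sub>0 int) monoid"
  where "tensor_free M S = free_Abelian_group (carrier M \<times> carrier S)"

definition tensor_kernel ::
    "('s, 'x) ring_scheme \<Rightarrow> ('s, 'm, 'z) right_module_scheme \<Rightarrow> ('s, 'y) ring_scheme \<Rightarrow>
     ('m \<times> 's \<Rightarrow>\<^sub>0 int) set"
  where "tensor_kernel R M S = generate (tensor_free M S) (tensor_relations R M S)"

definition tensor_act :: "('s, 'y) ring_scheme \<Rightarrow> 's \<Rightarrow> ('m \<times> 's \<Rightarrow>\<^sub>0 int) \<Rightarrow> ('m \<times> 's \<Rightarrow>\<^sub>0 int)"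
  where "tensor_act S t = frag_extend (\<lambda>(x, s). frag_of (x, s \<otimes>\<^bsub>S\<^esub> t))"

text \<open>
  The product of a coset \<open>X\<close> with \<open>t\<close> is the coset of the image of any representative, written
  as the union over all representatives, which all give the same coset.
\<close>

definition tensor ::
    "('s, 'x) ring_scheme \<Rightarrow> ('s, 'm, 'z) right_module_scheme \<Rightarrow> ('s, 'y) ring_scheme \<Rightarrow>
     ('s, ('m \<times> 's \<Rightarrow>\<^sub>0 int) set) right_module"
  where "tensor R M S =
    (let F = tensor_free M S; K = tensor_kernel R M S; Q = F Mod K in
     \<lparr>carrier = carrier Q, mult = undefined, one = undefined,
      zero = one Q, add = monoid.mult Q,
      rsmult = (\<lambda>X t. \<Union>c\<in>X. K #>\<^bsub>F\<^esub> tensor_act S t c)\<rparr>)"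

definition S_prime ::
    "('s, 'x) ring_scheme \<Rightarrow> ('s, 'y) ring_scheme \<Rightarrow> ('s, 'm, 'z) right_module_scheme \<Rightarrow> bool"
  where "S_prime R S L \<longleftrightarrow> prime_right_module S (tensor R L S)"

end

theory Submission
  imports Defs
begin

text \<open>
  The tensor product \<open>T = M \<otimes>\<^sub>R S\<close> is a graded \<open>S\<close>-module with identity component \<open>M\<close>, and for a
  submodule \<open>L\<close> of \<open>M\<close> strong gradedness gives \<open>ann (LS) = (J : G)S\<close> with \<open>J = ann L\<close>. Let \<open>u\<close> be a
  nonzero element of minimal support in a submodule \<open>U\<close> of \<open>T\<close>. By the unique product property the
  annihilator of \<open>u\<close> is graded and equals that of each nonzero component \<open>u\<^sub>g\<close>, so
  \<open>uS\<close> is isomorphic to \<open>u\<^sub>gS = NS\<close> with \<open>N = u\<^sub>gS \<inter> M\<close>. Hence a prime \<open>U\<close> has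
  the same annihilator as a prime submodule \<open>NS\<close>, and \<open>LS\<close> is prime exactly when
  \<open>ann (NS) = ann (LS)\<close> for all nonzero submodules \<open>N\<close> of \<open>L\<close>. As \<open>ann (NS)\<close> depends only on
  \<open>ann N\<close>, the latter holds for prime \<open>L\<close>, and under the chain condition every nonzero \<open>L\<close> contains
  a prime \<open>N\<close>.
\<close>

section \<open>Prime modules\<close>

text \<open>A submodule \<open>U\<close> of \<open>T\<close> need not be graded, whereas
  \<open>(J : G)S\<close> describes annihilators of graded submodules. The unique product property
  bridges this gap, and only annihilators are carried from \<open>U\<close> to \<open>NS\<close>,
  which need not lie in \<open>U\<close>.

  The formula \<open>(J : G)S\<close> has two sources. For \<open>r\<close> in \<open>R\<close>,
  \<open>LSr = 0\<close> means that \<open>S_{g^-1} r S_g\<close> lies in \<open>J\<close> for every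
  \<open>g\<close>, and since 1 lies in \<open>S_g S_{g^-1}\<close> this says that \<open>r\<close>
  lies in \<open>S_g J S_{g^-1}\<close>. Moreover \<open>ann (LS)\<close> is graded, and over a
  strongly graded ring a graded right ideal \<open>I\<close> is generated by its part in degree
  \<open>e\<close>, because \<open>I_h = I_h S_{h^-1} S_h\<close>.

  \<open>S\<close>-primeness of \<open>L\<close> speaks of a tensor product formed afresh from
  \<open>L\<close>, not of the submodule \<open>LS\<close> of \<open>T\<close>. Instead of
  identifying the two modules, the proof shows that each is prime under one and the same condition,
  which mentions only annihilators in \<open>R\<close> of submodules of \<open>L\<close>.\<close>

context right_module
begin

lemma zero_rsmult [simp]: "a \<in> carrier A \<Longrightarrow> \<zero>\<^bsub>M\<^esub> \<bullet>\<^bsub>M\<^esub> a = \<zero>\<^bsub>M\<^esub>"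
  using rsmult_l_distr[of "\<zero>\<^bsub>M\<^esub>" "\<zero>\<^bsub>M\<^esub>" a] rsmult_closed[of "\<zero>\<^bsub>M\<^esub>" a]
  by (metis M.add.l_cancel_one M.zero_closed M.l_zero)

lemma rsmult_zero [simp]: "x \<in> carrier M \<Longrightarrow> x \<bullet>\<^bsub>M\<^esub> \<zero>\<^bsub>A\<^esub> = \<zero>\<^bsub>M\<^esub>"
  using rsmult_r_distr[of x "\<zero>\<^bsub>A\<^esub>" "\<zero>\<^bsub>A\<^esub>"] rsmult_closed[of x "\<zero>\<^bsub>A\<^esub>"]
  by (metis M.add.l_cancel_one A.zero_closed A.l_zero)

lemma rsmult_l_minus:
  assumes "x \<in> carrier M" "a \<in> carrier A"
  shows "(\<ominus>\<^bsub>M\<^esub> x) \<bullet>\<^bsub>M\<^esub> a = \<ominus>\<^bsub>M\<^esub> (x \<bullet>\<^bsub>M\<^esub> a)"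
  using assms rsmult_l_distr[of "\<ominus>\<^bsub>M\<^esub> x" x a]
  by (metis M.a_inv_closed M.l_neg M.minus_equality rsmult_closed zero_rsmult)

lemma rsmult_r_minus:
  assumes "x \<in> carrier M" "a \<in> carrier A"
  shows "x \<bullet>\<^bsub>M\<^esub> (\<ominus>\<^bsub>A\<^esub> a) = \<ominus>\<^bsub>M\<^esub> (x \<bullet>\<^bsub>M\<^esub> a)"
  using assms rsmult_r_distr[of x "\<ominus>\<^bsub>A\<^esub> a" a]
  by (metis A.a_inv_closed A.l_neg M.minus_equality rsmult_closed rsmult_zero)

lemma right_submoduleI:
  assumes "N \<subseteq> carrier M" "\<zero>\<^bsub>M\<^esub> \<in> N"
    and "\<And>x y. \<lbrakk>x \<in> N; y \<in> N\<rbrakk> \<Longrightarrow> x \<oplus>\<^bsub>M\<^esub> y \<in> N"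
    and "\<And>x a. \<lbrakk>x \<in> N; a \<in> carrier A\<rbrakk> \<Longrightarrow> x \<bullet>\<^bsub>M\<^esub> a \<in> N"
  shows "right_submodule N A M"
proof -
  \<comment> \<open>Negation is the action of the scalar -1.\<close>
  have "\<ominus>\<^bsub>M\<^esub> x \<in> N" if "x \<in> N" for x
    using assms that rsmult_r_minus[of x "\<one>\<^bsub>A\<^esub>"] rsmult_one
    by (metis A.a_inv_closed A.one_closed subsetD)
  then have "subgroup N (add_monoid M)"
    using assms by (intro M.add.subgroupI) auto
  then show ?thesis
    using assms by (auto simp: right_submodule_def right_submodule_axioms_def additive_subgroup_def)
qed

lemma right_submodule_cyclic:
  assumes "x \<in> carrier M"
  shows "right_submodule ((\<lambda>a. x \<bullet>\<^bsub>M\<^esub> a) ` carrier A) A M"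
proof (rule right_submoduleI)
  show "\<zero>\<^bsub>M\<^esub> \<in> (\<lambda>a. x \<bullet>\<^bsub>M\<^esub> a) ` carrier A"
    using assms by (metis A.zero_closed image_eqI rsmult_zero)
next
  fix y z assume "y \<in> (\<lambda>a. x \<bullet>\<^bsub>M\<^esub> a) ` carrier A" "z \<in> (\<lambda>a. x \<bullet>\<^bsub>M\<^esub> a) ` carrier A"
  then show "y \<oplus>\<^bsub>M\<^esub> z \<in> (\<lambda>a. x \<bullet>\<^bsub>M\<^esub> a) ` carrier A"
    using assms by (auto simp: image_iff rsmult_r_distr[symmetric])
next
  fix y a assume "y \<in> (\<lambda>a. x \<bullet>\<^bsub>M\<^esub> a) ` carrier A" "a \<in> carrier A"
  then show "y \<bullet>\<^bsub>M\<^esub> a \<in> (\<lambda>a. x \<bullet>\<^bsub>M\<^esub> a) ` carrier A"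
    using assms by (auto simp: image_iff rsmult_assoc[symmetric])
qed (use assms rsmult_closed in auto)

lemma right_module_submodule:
  assumes "right_submodule N A M"
  shows "right_module A (M\<lparr>carrier := N\<rparr>)"
proof -
  interpret N: right_submodule N A M by fact
  have "abelian_group (M\<lparr>carrier := N\<rparr>)"
  proof (rule abelian_groupI)
    fix x assume "x \<in> carrier (M\<lparr>carrier := N\<rparr>)"
    then show "\<exists>y\<in>carrier (M\<lparr>carrier := N\<rparr>). y \<oplus>\<^bsub>M\<lparr>carrier := N\<rparr>\<^esub> x = \<zero>\<^bsub>M\<lparr>carrier := N\<rparr>\<^esub>"
      using M.l_neg N.a_subset by (auto intro!: bexI[of _ "\<ominus>\<^bsub>M\<^esub> x"])
  qed (use N.a_subset in \<open>auto simp: M.a_assoc M.a_comm M.a_lcomm subset_iff\<close>)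
  then show ?thesis
    using N.a_subset
    by (auto simp: right_module_def right_module_axioms_def A.ring_axioms subset_iff N.rsmult_mem
      rsmult_l_distr rsmult_r_distr rsmult_assoc rsmult_one)
qed

text \<open>Primeness of \<open>L\<close> quantifies over submodules of the restricted module; this
  turns them into submodules of \<open>M\<close> contained in \<open>L\<close>.\<close>

lemma right_submodule_trans:
  assumes "right_submodule L A M"
  shows "right_submodule N A (M\<lparr>carrier := L\<rparr>) \<longleftrightarrow> right_submodule N A M \<and> N \<subseteq> L"
proof
  interpret L: right_module A "M\<lparr>carrier := L\<rparr>"
    using assms by (rule right_module_submodule)
  interpret L': right_submodule L A M by fact
  show "right_submodule N A M \<and> N \<subseteq> L" if "right_submodule N A (M\<lparr>carrier := L\<rparr>)"
  proof -
    interpret N: right_submodule N A "M\<lparr>carrier := L\<rparr>" by fact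
    show ?thesis
      using N.a_subset L'.a_subset N.zero_closed N.a_closed N.rsmult_mem
      by (auto intro!: right_submoduleI)
  qed
  show "right_submodule N A (M\<lparr>carrier := L\<rparr>)" if "right_submodule N A M \<and> N \<subseteq> L"
  proof -
    interpret N: right_submodule N A M using that by blast
    show ?thesis
      using that N.zero_closed N.a_closed N.rsmult_mem by (auto intro!: L.right_submoduleI)
  qed
qed

lemma annihilator_ideal: "ideal (annihilator A M) A"
proof (rule idealI)
  show "subgroup (annihilator A M) (add_monoid A)"
    by (rule A.add.subgroupI) (auto simp: annihilator_def rsmult_r_distr rsmult_r_minus)
qed (auto simp: annihilator_def rsmult_assoc rsmult_closed A.ring_axioms)

text \<open>Annihilators reverse inclusion and every nonzero submodule contains a nonzero cyclic one
  \<open>xA\<close>, so primeness needs to be tested on cyclic submodules only.\<close>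

lemma prime_right_module_iff:
  "prime_right_module A M \<longleftrightarrow> carrier M \<noteq> {\<zero>\<^bsub>M\<^esub>} \<and>
     (\<forall>x\<in>carrier M - {\<zero>\<^bsub>M\<^esub>}. \<forall>a\<in>carrier A.
        (\<forall>b\<in>carrier A. (x \<bullet>\<^bsub>M\<^esub> b) \<bullet>\<^bsub>M\<^esub> a = \<zero>\<^bsub>M\<^esub>) \<longrightarrow> a \<in> annihilator A M)"
  (is "_ \<longleftrightarrow> ?R")
proof
  assume "prime_right_module A M"
  then interpret P: prime_right_module A M .
  have "a \<in> annihilator A M"
    if x: "x \<in> carrier M" "x \<noteq> \<zero>\<^bsub>M\<^esub>" and a: "a \<in> carrier A"
      and 0: "\<forall>b\<in>carrier A. (x \<bullet>\<^bsub>M\<^esub> b) \<bullet>\<^bsub>M\<^esub> a = \<zero>\<^bsub>M\<^esub>" for x a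
  proof -
    let ?N = "(\<lambda>a. x \<bullet>\<^bsub>M\<^esub> a) ` carrier A"
    have "x \<in> ?N" using x rsmult_one by (metis A.one_closed image_eqI)
    then have "annihilator A (M\<lparr>carrier := ?N\<rparr>) = annihilator A M"
      using P.annihilator_eq[OF right_submodule_cyclic[OF x(1)]] x by blast
    moreover have "a \<in> annihilator A (M\<lparr>carrier := ?N\<rparr>)"
      using a 0 by (auto simp: annihilator_def)
    ultimately show ?thesis by simp
  qed
  then show ?R using P.nonzero by blast
next
  assume R: ?R
  show "prime_right_module A M"
  proof (unfold_locales)
    fix N assume N: "right_submodule N A M" "N \<noteq> {\<zero>\<^bsub>M\<^esub>}"
    interpret N: right_submodule N A M by fact
    obtain x where x: "x \<in> N" "x \<noteq> \<zero>\<^bsub>M\<^esub>" using N(2) N.zero_closed by blast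
    have "a \<in> annihilator A M" if "a \<in> annihilator A (M\<lparr>carrier := N\<rparr>)" for a
    proof -
      have "x \<bullet>\<^bsub>M\<^esub> b \<bullet>\<^bsub>M\<^esub> a = \<zero>\<^bsub>M\<^esub>" if "b \<in> carrier A" for b
        using that \<open>a \<in> _\<close> N.rsmult_mem[OF x(1) that] by (auto simp: annihilator_def)
      moreover have "x \<in> carrier M - {\<zero>\<^bsub>M\<^esub>}" "a \<in> carrier A"
        using x N.a_subset that by (auto simp: annihilator_def)
      ultimately show ?thesis using R by blast
    qed
    then show "annihilator A (M\<lparr>carrier := N\<rparr>) = annihilator A M"
      using N.a_subset by (auto simp: annihilator_def)
  qed (use R in blast)
qed

end

section \<open>Prime submodules under the ascending chain condition\<close>

lemma annihilator_antimono:
  "N \<subseteq> L \<Longrightarrow> annihilator A (M\<lparr>carrier := L\<rparr>) \<subseteq> annihilator A (M\<lparr>carrier := N\<rparr>)"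
  by (auto simp: annihilator_def)

text \<open>A nonzero submodule whose annihilator is maximal is prime.\<close>

lemma (in right_module) acc_prime_submodule:
  assumes acc: "acc_on_ideals A" and L: "right_submodule L A M" "L \<noteq> {\<zero>\<^bsub>M\<^esub>}"
  obtains N where "right_submodule N A M" "N \<subseteq> L" "prime_right_module A (M\<lparr>carrier := N\<rparr>)"
proof -
  let ?ann = "\<lambda>N. annihilator A (M\<lparr>carrier := N\<rparr>)"
  define Q where "Q = {?ann N | N. right_submodule N A M \<and> N \<subseteq> L \<and> N \<noteq> {\<zero>\<^bsub>M\<^esub>}}"
  have ideals: "ideal I A" if "I \<in> Q" for I
    using that right_module.annihilator_ideal[OF right_module_submodule] by (auto simp: Q_def)
  \<comment> \<open>The relation is reversed strict inclusion: a descending chain in it is an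
    ascending chain of ideals, and a minimal element is a maximal annihilator.\<close>
  have wf: "wf {(J, I). I \<in> Q \<and> J \<in> Q \<and> I \<subset> J}"
    unfolding wf_iff_no_infinite_down_chain
  proof
    assume "\<exists>f. \<forall>i. (f (Suc i), f i) \<in> {(J, I). I \<in> Q \<and> J \<in> Q \<and> I \<subset> J}"
    then obtain f where f: "\<And>i. f i \<in> Q \<and> f i \<subset> f (Suc i)" by blast
    then have "\<forall>n. ideal (f n) A \<and> f n \<subseteq> f (Suc n)"
      using ideals by blast
    then obtain n where "\<forall>m\<ge>n. f m = f n"
      using acc unfolding acc_on_ideals_def by blast
    then have "f (Suc n) = f n" using le_SucI by blast
    then show False using f[of n] by blast
  qed
  have "?ann L \<in> Q" using L by (auto simp: Q_def)
  from wfE_min[OF wf this] obtain I where I: "I \<in> Q" "\<And>J. J \<in> Q \<Longrightarrow> \<not> I \<subset> J"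
    by (metis (mono_tags, lifting) case_prodI mem_Collect_eq)
  obtain N where N: "right_submodule N A M" "N \<subseteq> L" "N \<noteq> {\<zero>\<^bsub>M\<^esub>}" "I = ?ann N"
    using I(1) by (auto simp: Q_def)
  interpret N: right_module A "M\<lparr>carrier := N\<rparr>"
    using N(1) by (rule right_module_submodule)
  have "prime_right_module A (M\<lparr>carrier := N\<rparr>)"
  proof unfold_locales
    fix N' assume "right_submodule N' A (M\<lparr>carrier := N\<rparr>)" "N' \<noteq> {\<zero>\<^bsub>M\<lparr>carrier := N\<rparr>\<^esub>}"
    then have N': "right_submodule N' A M" "N' \<subseteq> N" "N' \<noteq> {\<zero>\<^bsub>M\<^esub>}"
      using right_submodule_trans[OF N(1)] by auto
    have "?ann N' \<in> Q" unfolding Q_def using N N' by blast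
    then have "?ann N' = ?ann N"
      using I(2) N(4) annihilator_antimono[OF N'(2), of A M] by blast
    then show "annihilator A (M\<lparr>carrier := N, carrier := N'\<rparr>) = ?ann N"
      by simp
  qed (use N in simp)
  then show thesis using that N by blast
qed

section \<open>Homogeneous components\<close>

lemma (in abelian_group) finsum_hom:
  assumes B: "abelian_group B" and h: "h \<in> hom (add_monoid G) (add_monoid B)"
    and f: "f \<in> X \<rightarrow> carrier G"
  shows "h (finsum G f X) = finsum B (\<lambda>i. h (f i)) X"
proof -
  interpret B: abelian_group B by fact
  interpret h: group_hom "add_monoid G" "add_monoid B" h
    using h by (simp add: group_hom_def group_hom_axioms_def a_group B.a_group)
  have "h \<zero> = \<zero>\<^bsub>B\<^esub>" using h.hom_one by simp
  moreover have "h x \<in> carrier B" if "x \<in> carrier G" for x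
    using h.hom_closed that by simp
  moreover have "h (x \<oplus> y) = h x \<oplus>\<^bsub>B\<^esub> h y" if "x \<in> carrier G" "y \<in> carrier G" for x y
    using h.hom_mult that by simp
  \<comment> \<open>For infinite \<open>X\<close> both sums are zero by default, and
    \<open>h\<close> preserves zero.\<close>
  ultimately show ?thesis
    using f by (induct X rule: infinite_finite_induct) (auto simp: Pi_def)
qed

context graded_ring
begin

text \<open>The extensional function space fixes the coefficients outside the group, which is what
  makes the decomposition unique; hence \<open>component g\<close> is meaningful only for
  \<open>g\<close> in the group.\<close>

definition component :: "_ \<Rightarrow> _ \<Rightarrow> _" where
  "component g s =
    (THE f. f \<in> (\<Pi>\<^sub>E g\<in>carrier G. D g) \<and> finite {g \<in> carrier G. f g \<noteq> \<zero>\<^bsub>S\<^esub>} \<and>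
            s = finsum S f {g \<in> carrier G. f g \<noteq> \<zero>\<^bsub>S\<^esub>}) g"

lemma component_set_closed [simp]:
  assumes "g \<in> carrier G"
  shows "x \<in> D g \<Longrightarrow> x \<in> carrier S" "\<zero>\<^bsub>S\<^esub> \<in> D g"
    "\<lbrakk>x \<in> D g; y \<in> D g\<rbrakk> \<Longrightarrow> x \<oplus>\<^bsub>S\<^esub> y \<in> D g"
proof -
  interpret Dg: additive_subgroup "D g" S using assms by (rule component_subgroup)
  show "x \<in> D g \<Longrightarrow> x \<in> carrier S" "\<zero>\<^bsub>S\<^esub> \<in> D g"
    "\<lbrakk>x \<in> D g; y \<in> D g\<rbrakk> \<Longrightarrow> x \<oplus>\<^bsub>S\<^esub> y \<in> D g"
    using Dg.a_subset by auto
qed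

lemma component_set_mult:
  "\<lbrakk>g \<in> carrier G; h \<in> carrier G; x \<in> D g; y \<in> D h\<rbrakk> \<Longrightarrow> x \<otimes>\<^bsub>S\<^esub> y \<in> D (g \<otimes> h)"
  by (rule subsetD[OF component_mult ideal_prod.prod])

lemma component_properties:
  assumes "s \<in> carrier S"
  shows component_mem [simp]: "g \<in> carrier G \<Longrightarrow> component g s \<in> D g"
    and finite_component: "finite {g \<in> carrier G. component g s \<noteq> \<zero>\<^bsub>S\<^esub>}"
    and component_finsum:
      "s = finsum S (\<lambda>g. component g s) {g \<in> carrier G. component g s \<noteq> \<zero>\<^bsub>S\<^esub>}"
proof -
  note * = theI'[OF direct_sum[OF assms]]
  then show "g \<in> carrier G \<Longrightarrow> component g s \<in> D g"
    unfolding component_def by (blast intro: PiE_mem)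
  show "finite {g \<in> carrier G. component g s \<noteq> \<zero>\<^bsub>S\<^esub>}"
    "s = finsum S (\<lambda>g. component g s) {g \<in> carrier G. component g s \<noteq> \<zero>\<^bsub>S\<^esub>}"
    unfolding component_def by (rule *[THEN conjunct2, THEN conjunct1],
      rule *[THEN conjunct2, THEN conjunct2])
qed

lemma component_closed [simp]:
  "\<lbrakk>g \<in> carrier G; s \<in> carrier S\<rbrakk> \<Longrightarrow> component g s \<in> carrier S"
  using component_mem component_set_closed(1) by blast

lemma component_finsum_superset:
  assumes "s \<in> carrier S" "finite X" "{g \<in> carrier G. component g s \<noteq> \<zero>\<^bsub>S\<^esub>} \<subseteq> X" "X \<subseteq> carrier G"
  shows "s = finsum S (\<lambda>g. component g s) X"
proof -
  have "finsum S (\<lambda>g. component g s) {g \<in> carrier G. component g s \<noteq> \<zero>\<^bsub>S\<^esub>} =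
      finsum S (\<lambda>g. component g s) X"
    using assms by (intro S.add.finprod_mono_neutral_cong_left) auto
  with component_finsum[OF assms(1)] show ?thesis by (rule trans)
qed

text \<open>The uniqueness half of the direct sum decomposition, in a form that reads off components
  from any finite sum of homogeneous elements of distinct degrees.\<close>

lemma component_eqI:
  assumes X: "finite X" "X \<subseteq> carrier G" and f: "\<And>g. g \<in> X \<Longrightarrow> f g \<in> D g" and g: "g \<in> carrier G"
  shows "component g (finsum S f X) = (if g \<in> X then f g else \<zero>\<^bsub>S\<^esub>)"
proof -
  let ?P = "\<lambda>s f. f \<in> (\<Pi>\<^sub>E g\<in>carrier G. D g) \<and> finite {g \<in> carrier G. f g \<noteq> \<zero>\<^bsub>S\<^esub>} \<and>
            s = finsum S f {g \<in> carrier G. f g \<noteq> \<zero>\<^bsub>S\<^esub>}"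
  \<comment> \<open>Some \<open>f g\<close> with \<open>g\<close> in \<open>X\<close> may vanish,
    while \<open>direct_sum\<close> sums over the exact support; so \<open>f\<close> is extended by
    zero and the sum is then cut down to the support of the extension.\<close>
  define f' where "f' = (\<lambda>g\<in>carrier G. if g \<in> X then f g else \<zero>\<^bsub>S\<^esub>)"
  have "finsum S f' {g \<in> carrier G. f' g \<noteq> \<zero>\<^bsub>S\<^esub>} = finsum S f X"
    using X f component_set_closed(1)
    by (intro S.add.finprod_mono_neutral_cong_left) (auto simp: f'_def split: if_splits)
  moreover have "finite {g \<in> carrier G. f' g \<noteq> \<zero>\<^bsub>S\<^esub>}"
    using X by (auto simp: f'_def intro: finite_subset[OF _ X(1)] split: if_splits)
  moreover have "f' \<in> (\<Pi>\<^sub>E g\<in>carrier G. D g)"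
    using f by (auto simp: f'_def)
  ultimately have P: "?P (finsum S f X) f'"
    by (metis (no_types, lifting))
  have "finsum S f X \<in> carrier S"
    using X f component_set_closed(1) by (intro S.finsum_closed) auto
  from direct_sum[OF this] P have "(THE f'. ?P (finsum S f X) f') = f'"
    by - (erule the1_equality)
  then have "component g (finsum S f X) = f' g"
    unfolding component_def by (rule fun_cong)
  then show ?thesis
    using g by (simp add: f'_def)
qed

lemma component_add:
  assumes g: "g \<in> carrier G" and s: "s \<in> carrier S" and t: "t \<in> carrier S"
  shows "component g (s \<oplus>\<^bsub>S\<^esub> t) = component g s \<oplus>\<^bsub>S\<^esub> component g t"
proof -
  \<comment> \<open>A common index set for both sums; \<open>g\<close> is put in so that the case
    distinction of \<open>component_eqI\<close> at \<open>g\<close> disappears.\<close>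
  define X where "X = insert g ({g \<in> carrier G. component g s \<noteq> \<zero>\<^bsub>S\<^esub>} \<union>
    {g \<in> carrier G. component g t \<noteq> \<zero>\<^bsub>S\<^esub>})"
  have X: "finite X" "X \<subseteq> carrier G" "g \<in> X"
    using g s t by (auto simp: X_def finite_component)
  have "s = finsum S (\<lambda>g. component g s) X" "t = finsum S (\<lambda>g. component g t) X"
    using s t X by (auto simp: X_def intro!: component_finsum_superset)
  then have "s \<oplus>\<^bsub>S\<^esub> t = finsum S (\<lambda>g. component g s) X \<oplus>\<^bsub>S\<^esub> finsum S (\<lambda>g. component g t) X"
    by (rule arg_cong2)
  also have "\<dots> = finsum S (\<lambda>g. component g s \<oplus>\<^bsub>S\<^esub> component g t) X"
    using X s t by (intro S.finsum_addf[symmetric]) auto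
  finally have eq: "s \<oplus>\<^bsub>S\<^esub> t = \<dots>" .
  have "component g (s \<oplus>\<^bsub>S\<^esub> t) = (if g \<in> X then component g s \<oplus>\<^bsub>S\<^esub> component g t else \<zero>\<^bsub>S\<^esub>)"
    unfolding eq using X s t g by (intro component_eqI) auto
  then show ?thesis using X by simp
qed

lemma component_homogeneous:
  assumes "g \<in> carrier G" "h \<in> carrier G" "s \<in> D h"
  shows "component g s = (if g = h then s else \<zero>\<^bsub>S\<^esub>)"
  using component_eqI[of "{h}" "\<lambda>_. s" g] assms by simp

text \<open>In contrast to \<open>homogeneous_induct\<close>, the base case concerns only the
  components of the given \<open>s\<close>. This matters when \<open>P\<close> is known just for
  these, for instance because each of them kills a fixed module element.\<close>

lemma component_induct:
  assumes s: "s \<in> carrier S" and "P \<zero>\<^bsub>S\<^esub>"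
    and comp: "\<And>g. g \<in> carrier G \<Longrightarrow> P (component g s)"
    and add: "\<And>a b. \<lbrakk>a \<in> carrier S; b \<in> carrier S; P a; P b\<rbrakk> \<Longrightarrow> P (a \<oplus>\<^bsub>S\<^esub> b)"
  shows "P s"
proof -
  have "P (finsum S (\<lambda>g. component g s) X)" if "finite X" "X \<subseteq> carrier G" for X
    using that
  proof induction
    case (insert g X)
    then have "(\<lambda>g. component g s) \<in> X \<rightarrow> carrier S" using s by auto
    then show ?case
      using insert s comp add[of "component g s" "finsum S (\<lambda>g. component g s) X"] by simp
  qed (use assms in simp)
  from this[OF finite_component[OF s]] show ?thesis
    by (subst component_finsum[OF s]) blast
qed

lemma homogeneous_induct [consumes 1, case_names zero homogeneous add]:
  assumes "s \<in> carrier S" and "P \<zero>\<^bsub>S\<^esub>"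
    and "\<And>g a. \<lbrakk>g \<in> carrier G; a \<in> D g\<rbrakk> \<Longrightarrow> P a"
    and "\<And>a b. \<lbrakk>a \<in> carrier S; b \<in> carrier S; P a; P b\<rbrakk> \<Longrightarrow> P (a \<oplus>\<^bsub>S\<^esub> b)"
  shows "P s"
  by (rule component_induct) (use assms component_mem in blast)+

lemma component_zero [simp]: "g \<in> carrier G \<Longrightarrow> component g \<zero>\<^bsub>S\<^esub> = \<zero>\<^bsub>S\<^esub>"
  using component_homogeneous[of g g "\<zero>\<^bsub>S\<^esub>"] by simp

lemma component_component:
  "\<lbrakk>g \<in> carrier G; h \<in> carrier G; s \<in> carrier S\<rbrakk> \<Longrightarrow>
     component g (component h s) = (if g = h then component g s else \<zero>\<^bsub>S\<^esub>)"
  by (simp add: component_homogeneous)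

text \<open>A factor of degree \<open>h\<close> moves degrees by a translation of the group, which
  is injective, so distinct components do not mix.\<close>

lemma component_mult_right:
  assumes "g \<in> carrier G" "h \<in> carrier G" "s \<in> carrier S" "c \<in> D h"
  shows "component (g \<otimes> h) (s \<otimes>\<^bsub>S\<^esub> c) = component g s \<otimes>\<^bsub>S\<^esub> c"
  using assms(3)
proof (induction rule: homogeneous_induct)
  case (homogeneous k a)
  then have "g \<otimes> h = k \<otimes> h \<longleftrightarrow> g = k" using assms by simp
  moreover have "a \<otimes>\<^bsub>S\<^esub> c \<in> D (k \<otimes> h)"
    using homogeneous assms component_set_mult by simp
  ultimately show ?case
    using assms homogeneous component_homogeneous[of "g \<otimes> h" "k \<otimes> h" "a \<otimes>\<^bsub>S\<^esub> c"]
      component_homogeneous[of g k a] component_set_closed(1)[of h c] by auto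
qed (use assms component_set_closed(1)[of h c] in \<open>auto simp: component_add S.l_distr\<close>)

lemma component_mult_left:
  assumes "g \<in> carrier G" "h \<in> carrier G" "s \<in> carrier S" "c \<in> D h"
  shows "component (h \<otimes> g) (c \<otimes>\<^bsub>S\<^esub> s) = c \<otimes>\<^bsub>S\<^esub> component g s"
  using assms(3)
proof (induction rule: homogeneous_induct)
  case (homogeneous k a)
  then have "h \<otimes> g = h \<otimes> k \<longleftrightarrow> g = k" using assms by simp
  moreover have "c \<otimes>\<^bsub>S\<^esub> a \<in> D (h \<otimes> k)"
    using homogeneous assms component_set_mult by simp
  ultimately show ?case
    using assms homogeneous component_homogeneous[of "h \<otimes> g" "h \<otimes> k" "c \<otimes>\<^bsub>S\<^esub> a"]
      component_homogeneous[of g k a] component_set_closed(1)[of h c] by auto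
qed (use assms component_set_closed(1)[of h c] in \<open>auto simp: component_add S.r_distr\<close>)

lemma base_ring_simps [simp]:
  "carrier (base_ring G S D) = D \<one>" "mult (base_ring G S D) = mult S"
  "one (base_ring G S D) = one S" "zero (base_ring G S D) = zero S" "add (base_ring G S D) = add S"
  by (simp_all add: base_ring_def)

end

section \<open>Graded modules over strongly graded rings\<close>

text \<open>Typically \<open>H\<close> collects all \<open>w\<close> with some additive property: it
  is then checked on products from opposite degrees and applied to 1, which is a sum of such
  products.\<close>

lemma ideal_prod_subsetI:
  assumes "\<And>i j. \<lbrakk>i \<in> I; j \<in> J\<rbrakk> \<Longrightarrow> i \<otimes>\<^bsub>R\<^esub> j \<in> H"
    and "\<And>a b. \<lbrakk>a \<in> H; b \<in> H\<rbrakk> \<Longrightarrow> a \<oplus>\<^bsub>R\<^esub> b \<in> H"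
  shows "I \<cdot>\<^bsub>R\<^esub> J \<subseteq> H"
proof
  fix x assume "x \<in> I \<cdot>\<^bsub>R\<^esub> J"
  then show "x \<in> H" by induction (use assms in auto)
qed

text \<open>The grading is given by orthogonal projections instead of subgroups.
  \<open>proj_span\<close> expresses that \<open>t\<close> is the sum of its components in the form
  in which this is used: membership in an additive subgroup may be checked on components.\<close>

locale graded_right_module = strongly_graded_ring G S D + T?: right_module S T
  for G (structure) and S (structure) and D and T (structure) +
  fixes proj
  assumes proj_closed [simp]: "\<lbrakk>g \<in> carrier G; t \<in> carrier T\<rbrakk> \<Longrightarrow> proj g t \<in> carrier T"
    and proj_add: "\<lbrakk>g \<in> carrier G; t \<in> carrier T; u \<in> carrier T\<rbrakk> \<Longrightarrow>
      proj g (t \<oplus>\<^bsub>T\<^esub> u) = proj g t \<oplus>\<^bsub>T\<^esub> proj g u"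
    and proj_proj: "\<lbrakk>g \<in> carrier G; h \<in> carrier G; t \<in> carrier T\<rbrakk> \<Longrightarrow>
      proj g (proj h t) = (if g = h then proj g t else \<zero>\<^bsub>T\<^esub>)"
    and finite_proj: "t \<in> carrier T \<Longrightarrow> finite {g \<in> carrier G. proj g t \<noteq> \<zero>\<^bsub>T\<^esub>}"
    and proj_span: "\<lbrakk>t \<in> carrier T; additive_subgroup H T; \<And>g. g \<in> carrier G \<Longrightarrow> proj g t \<in> H\<rbrakk> \<Longrightarrow> t \<in> H"
    and proj_rsmult: "\<lbrakk>g \<in> carrier G; h \<in> carrier G; t \<in> carrier T; a \<in> D h\<rbrakk> \<Longrightarrow>
      proj (g \<otimes> h) (t \<bullet>\<^bsub>T\<^esub> a) = proj g t \<bullet>\<^bsub>T\<^esub> a"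
begin

declare rsmult_closed [simp]

lemma proj_zero [simp]: "g \<in> carrier G \<Longrightarrow> proj g \<zero>\<^bsub>T\<^esub> = \<zero>\<^bsub>T\<^esub>"
  using proj_rsmult[of g \<one> "\<zero>\<^bsub>T\<^esub>" "\<zero>\<^bsub>S\<^esub>"] by simp

lemma proj_rsmult':
  assumes "k \<in> carrier G" "h \<in> carrier G" "t \<in> carrier T" "a \<in> D h"
  shows "proj k (t \<bullet>\<^bsub>T\<^esub> a) = proj (k \<otimes> inv h) t \<bullet>\<^bsub>T\<^esub> a"
  using proj_rsmult[of "k \<otimes> inv h" h t a] assms by (simp add: G.m_assoc)

text \<open>These kernels serve as \<open>H\<close> in \<open>proj_span\<close> and
  \<open>mem_of_prod\<close>. For \<open>s = 1\<close> the kernel is zero, so the same rules also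
  show that an element vanishes.\<close>

lemma additive_subgroup_kernel:
  assumes "s \<in> carrier S"
  shows "additive_subgroup {t \<in> carrier T. t \<bullet>\<^bsub>T\<^esub> s = \<zero>\<^bsub>T\<^esub>} T"
  unfolding additive_subgroup_def
  by (rule T.M.add.subgroupI) (use assms in \<open>auto simp: rsmult_l_distr rsmult_l_minus\<close>)

lemma proj_eq_zero:
  assumes "t \<in> carrier T" "\<And>g. g \<in> carrier G \<Longrightarrow> proj g t = \<zero>\<^bsub>T\<^esub>"
  shows "t = \<zero>\<^bsub>T\<^esub>"
  using proj_span[OF assms(1) additive_subgroup_kernel[of "\<one>\<^bsub>S\<^esub>"]] assms rsmult_one by auto

text \<open>The counterpart of \<open>proj_rsmult\<close> with exchanged roles: the module element
  is homogeneous and the scalar arbitrary, so components of the product come from components of the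
  scalar.\<close>

lemma proj_rsmult_component:
  assumes "g \<in> carrier G" "h \<in> carrier G" "t \<in> carrier T" "s \<in> carrier S"
  shows "proj (g \<otimes> h) (proj g t \<bullet>\<^bsub>T\<^esub> s) = proj g t \<bullet>\<^bsub>T\<^esub> component h s"
  using assms(4)
proof (induction rule: homogeneous_induct)
  case (homogeneous k a)
  have eq: "g \<otimes> h \<otimes> inv k = g \<longleftrightarrow> h = k"
    using assms homogeneous G.inv_solve_right'[of g "g \<otimes> h" k] by auto
  have "g \<otimes> k \<otimes> inv k = g"
    using assms homogeneous by (simp add: G.m_assoc)
  then show ?case
    using assms homogeneous component_set_closed(1)[of k a]
    by (auto simp: proj_rsmult'[of _ k] proj_proj eq component_homogeneous)
qed (use assms in \<open>auto simp: rsmult_r_distr proj_add component_add\<close>)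

text \<open>The only form in which strong gradedness enters the argument.\<close>

lemma one_mem_prod:
  assumes "g \<in> carrier G"
  shows "\<one>\<^bsub>S\<^esub> \<in> D g \<cdot>\<^bsub>S\<^esub> D (inv g)" "\<one>\<^bsub>S\<^esub> \<in> D (inv g) \<cdot>\<^bsub>S\<^esub> D g"
  using strong[of g "inv g"] strong[of "inv g" g] assms one_component by auto

text \<open>Writing 1 as a sum of products \<open>bc\<close> gives \<open>t\<close> as the sum of
  the \<open>tbc\<close>. For \<open>t\<close> of degree \<open>g\<close> each \<open>tb\<close> has
  degree \<open>e\<close>, which reduces claims about \<open>t\<close> to the identity
  component.\<close>

lemma mem_of_prod:
  assumes g: "g \<in> carrier G" and t: "t \<in> carrier T" and H: "additive_subgroup H T"
    and "\<And>b c. \<lbrakk>b \<in> D (inv g); c \<in> D g\<rbrakk> \<Longrightarrow> (t \<bullet>\<^bsub>T\<^esub> b) \<bullet>\<^bsub>T\<^esub> c \<in> H"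
  shows "t \<in> H"
proof -
  interpret H: additive_subgroup H T by fact
  have "D (inv g) \<cdot>\<^bsub>S\<^esub> D g \<subseteq> {w \<in> carrier S. t \<bullet>\<^bsub>T\<^esub> w \<in> H}"
    using assms component_set_closed(1)[of g] component_set_closed(1)[of "inv g"]
    by (intro ideal_prod_subsetI) (auto simp: rsmult_r_distr rsmult_assoc)
  then have "t \<bullet>\<^bsub>T\<^esub> \<one>\<^bsub>S\<^esub> \<in> H"
    using one_mem_prod(2)[OF g] by auto
  then show ?thesis using t rsmult_one by simp
qed

text \<open>
  For \<open>u\<close> of minimal support, a homogeneous element killing one component of \<open>u\<close> kills \<open>u\<close>; the
  unique product property then shows that the annihilator of \<open>u\<close> is graded.
\<close>

lemma minimal_support:
  assumes up: "unique_product_group G" and U: "right_submodule U S T" "U \<noteq> {\<zero>\<^bsub>T\<^esub>}"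
  obtains u g where "u \<in> U" "g \<in> carrier G" "proj g u \<noteq> \<zero>\<^bsub>T\<^esub>"
    "\<And>s. s \<in> carrier S \<Longrightarrow> u \<bullet>\<^bsub>T\<^esub> s = \<zero>\<^bsub>T\<^esub> \<longleftrightarrow> proj g u \<bullet>\<^bsub>T\<^esub> s = \<zero>\<^bsub>T\<^esub>"
proof -
  interpret U: right_submodule U S T by fact
  define supp where "supp t = {g \<in> carrier G. proj g t \<noteq> \<zero>\<^bsub>T\<^esub>}" for t
  obtain w where "w \<in> U \<and> w \<noteq> \<zero>\<^bsub>T\<^esub>" using U U.zero_closed by blast
  from ex_has_least_nat[where P = "\<lambda>u. u \<in> U \<and> u \<noteq> \<zero>\<^bsub>T\<^esub>", OF this, of "\<lambda>u. card (supp u)"]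
  obtain u where u: "u \<in> U" "u \<noteq> \<zero>\<^bsub>T\<^esub>"
    and min: "\<And>v. \<lbrakk>v \<in> U; v \<noteq> \<zero>\<^bsub>T\<^esub>\<rbrakk> \<Longrightarrow> card (supp u) \<le> card (supp v)"
    by blast
  have uT [simp]: "u \<in> carrier T" using u U.a_subset by blast
  have fin: "finite (supp u)" using finite_proj[OF uT] by (simp add: supp_def)
  \<comment> \<open>Multiplication by \<open>c\<close> translates the support of \<open>u\<close>
    and loses \<open>k\<close>, so a nonzero \<open>uc\<close> would be an element of
    \<open>U\<close> with smaller support.\<close>
  have homogeneous: "u \<bullet>\<^bsub>T\<^esub> c = \<zero>\<^bsub>T\<^esub>"
    if k: "k \<in> supp u" "proj k u \<bullet>\<^bsub>T\<^esub> c = \<zero>\<^bsub>T\<^esub>" and h: "h \<in> carrier G" "c \<in> D h" for k h c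
  proof (rule ccontr)
    assume nz: "u \<bullet>\<^bsub>T\<^esub> c \<noteq> \<zero>\<^bsub>T\<^esub>"
    have c: "c \<in> carrier S" using h component_set_closed(1) by blast
    have "supp (u \<bullet>\<^bsub>T\<^esub> c) \<subseteq> (\<lambda>g. g \<otimes> h) ` (supp u - {k})"
    proof
      fix g assume g: "g \<in> supp (u \<bullet>\<^bsub>T\<^esub> c)"
      then have "proj (g \<otimes> inv h) u \<bullet>\<^bsub>T\<^esub> c \<noteq> \<zero>\<^bsub>T\<^esub>" "g \<in> carrier G"
        using h proj_rsmult'[of g h u c] by (auto simp: supp_def)
      then have "g \<otimes> inv h \<in> supp u - {k}"
        using c k h by (auto simp: supp_def)
      then show "g \<in> (\<lambda>g. g \<otimes> h) ` (supp u - {k})"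
        using \<open>g \<in> carrier G\<close> h by (intro image_eqI[where x = "g \<otimes> inv h"]) (auto simp: G.m_assoc)
    qed
    then have "card (supp (u \<bullet>\<^bsub>T\<^esub> c)) \<le> card (supp u - {k})"
      using fin by (meson card_image_le card_mono finite_Diff finite_imageI order_trans)
    also have "\<dots> < card (supp u)"
      using fin k by (meson card_Diff1_less)
    finally show False
      using min[OF U.rsmult_mem[OF u(1) c] nz] by simp
  qed
  have supp_nonempty: "supp u \<noteq> {}"
    using proj_eq_zero[OF uT] u by (auto simp: supp_def)
  have component_kill: "\<forall>h\<in>carrier G. u \<bullet>\<^bsub>T\<^esub> component h s = \<zero>\<^bsub>T\<^esub>"
    if "s \<in> carrier S" "u \<bullet>\<^bsub>T\<^esub> s = \<zero>\<^bsub>T\<^esub>" for s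
    using that
  \<comment> \<open>The number of nonzero components of \<open>s\<close> decreases: one of them is
    found to kill \<open>u\<close> and is then subtracted from \<open>s\<close>.\<close>
  proof (induction "card {h \<in> carrier G. component h s \<noteq> \<zero>\<^bsub>S\<^esub>}" arbitrary: s rule: less_induct)
    case (less s)
    let ?Y = "\<lambda>s. {h \<in> carrier G. component h s \<noteq> \<zero>\<^bsub>S\<^esub>}"
    show ?case
    proof (cases "?Y s = {}")
      case True
      then show ?thesis using uT by auto
    next
      case False
      obtain g h where g: "g \<in> supp u" and h: "h \<in> ?Y s"
        and unique: "\<And>x y. \<lbrakk>x \<in> supp u; y \<in> ?Y s; (x, y) \<noteq> (g, h)\<rbrakk> \<Longrightarrow> g \<otimes> h \<noteq> x \<otimes> y"
        using unique_product_group.unique_product[OF up fin supp_nonempty _ finite_component[OF less.prems(1)] False]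
        unfolding supp_def by blast
      have gG: "g \<in> carrier G" and hG: "h \<in> carrier G" using g h by (auto simp: supp_def)
      \<comment> \<open>No other pair of support elements has product \<open>gh\<close>, so
        \<open>u_g s_h\<close> is the whole degree \<open>gh\<close> part of \<open>us = 0\<close>.
        The computation is done for each component \<open>s_k\<close> of \<open>s\<close>: for
        \<open>k\<close> other than \<open>h\<close>, a nonzero contribution would give the second
        factorization of \<open>gh\<close> into \<open>ghk^-1\<close> and \<open>k\<close>.\<close>
      have "proj (g \<otimes> h) (u \<bullet>\<^bsub>T\<^esub> s) = proj g u \<bullet>\<^bsub>T\<^esub> component h s"
        using less.prems(1)
      proof (rule component_induct)
        fix k assume k: "k \<in> carrier G"
        show "proj (g \<otimes> h) (u \<bullet>\<^bsub>T\<^esub> component k s) = proj g u \<bullet>\<^bsub>T\<^esub> component h (component k s)"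
        proof (cases "k = h")
          case True
          then show ?thesis
            using less.prems gG hG by (simp add: component_component proj_rsmult)
        next
          case neq: False
          have "proj (g \<otimes> h \<otimes> inv k) u \<bullet>\<^bsub>T\<^esub> component k s = \<zero>\<^bsub>T\<^esub>"
          proof (cases "component k s = \<zero>\<^bsub>S\<^esub>")
            case False
            have "g \<otimes> h = g \<otimes> h \<otimes> inv k \<otimes> k"
              using gG hG k by (simp add: G.m_assoc)
            then have "g \<otimes> h \<otimes> inv k \<notin> supp u"
              using unique[of "g \<otimes> h \<otimes> inv k" k] neq k False by auto
            then show ?thesis
              using gG hG k less.prems by (simp add: supp_def)
          qed (use gG hG k in simp)
          then show ?thesis
            using gG hG k neq less.prems by (simp add: component_component proj_rsmult'[of _ k])
        qed
      qed (use gG hG in \<open>auto simp: component_add rsmult_r_distr proj_add\<close>)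
      then have kill: "u \<bullet>\<^bsub>T\<^esub> component h s = \<zero>\<^bsub>T\<^esub>"
        using homogeneous[of g "component h s" h] g gG hG less.prems by simp
      \<comment> \<open>This is \<open>s - s_h\<close>, written as a sum so that
        \<open>component_add\<close> yields its components.\<close>
      define s' where "s' = s \<oplus>\<^bsub>S\<^esub> component h (\<ominus>\<^bsub>S\<^esub> s)"
      have s': "s' \<in> carrier S" using less.prems hG by (simp add: s'_def)
      have neg: "component h (\<ominus>\<^bsub>S\<^esub> s) = \<ominus>\<^bsub>S\<^esub> component h s"
        using less.prems hG component_add[of h "\<ominus>\<^bsub>S\<^esub> s" s]
        by (simp add: S.l_neg S.minus_equality)
      have "component h s \<oplus>\<^bsub>S\<^esub> component h (\<ominus>\<^bsub>S\<^esub> s) = \<zero>\<^bsub>S\<^esub>"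
        using less.prems hG by (simp add: neg S.r_neg)
      then have comp: "component k s' = (if k = h then \<zero>\<^bsub>S\<^esub> else component k s)" if "k \<in> carrier G" for k
        using less.prems hG that
        by (auto simp: s'_def component_add component_component)
      have Y: "?Y s' = ?Y s - {h}" using hG by (auto simp: comp split: if_splits)
      have "card (?Y s') < card (?Y s)"
        unfolding Y using finite_component[OF less.prems(1)] h by (rule card_Diff1_less)
      moreover have "u \<bullet>\<^bsub>T\<^esub> s' = \<zero>\<^bsub>T\<^esub>"
        using less.prems hG kill neg by (simp add: s'_def rsmult_r_distr rsmult_r_minus)
      ultimately have "\<forall>k\<in>carrier G. u \<bullet>\<^bsub>T\<^esub> component k s' = \<zero>\<^bsub>T\<^esub>"
        using less.hyps s' by blast
      then show ?thesis using kill by (metis comp)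
    qed
  qed
  obtain g where g: "g \<in> supp u" using supp_nonempty by blast
  then have gG: "g \<in> carrier G" by (simp add: supp_def)
  have "u \<bullet>\<^bsub>T\<^esub> s = \<zero>\<^bsub>T\<^esub> \<longleftrightarrow> proj g u \<bullet>\<^bsub>T\<^esub> s = \<zero>\<^bsub>T\<^esub>" if s: "s \<in> carrier S" for s
  proof
    assume "u \<bullet>\<^bsub>T\<^esub> s = \<zero>\<^bsub>T\<^esub>"
    then have kill: "proj g u \<bullet>\<^bsub>T\<^esub> component h s = \<zero>\<^bsub>T\<^esub>" if "h \<in> carrier G" for h
      using component_kill[OF s] that gG s proj_rsmult[of g h u "component h s"] by simp
    show "proj g u \<bullet>\<^bsub>T\<^esub> s = \<zero>\<^bsub>T\<^esub>"
      by (rule component_induct[OF s]) (use gG kill in \<open>auto simp: rsmult_r_distr\<close>)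
  next
    \<comment> \<open>Since \<open>u_g\<close> is homogeneous, \<open>u_g s = 0\<close> splits into
      the equations \<open>u_g s_h = 0\<close>, and minimality transfers each of them to
      \<open>u\<close>.\<close>
    assume "proj g u \<bullet>\<^bsub>T\<^esub> s = \<zero>\<^bsub>T\<^esub>"
    then have kill: "u \<bullet>\<^bsub>T\<^esub> component h s = \<zero>\<^bsub>T\<^esub>" if "h \<in> carrier G" for h
      using that gG s proj_rsmult_component[of g h u s] homogeneous[OF g, of "component h s" h] by simp
    show "u \<bullet>\<^bsub>T\<^esub> s = \<zero>\<^bsub>T\<^esub>"
      by (rule component_induct[OF s]) (use kill in \<open>auto simp: rsmult_r_distr\<close>)
  qed
  then show thesis using that[OF u(1) gG] g by (simp add: supp_def)
qed

end

text \<open>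
  Such a \<open>T\<close> is isomorphic to \<open>M \<otimes>\<^sub>R S\<close>; the axioms allow the argument to avoid the concrete
  construction of the tensor product.
\<close>

locale graded_extension = graded_right_module G S D T proj + M?: right_module "base_ring G S D" M
  for G (structure) and S (structure) and D and T (structure) and proj
    and M (structure) +
  fixes iota (\<open>\<iota>\<close>)
  assumes iota_closed [simp]: "x \<in> carrier M \<Longrightarrow> \<iota> x \<in> carrier T"
    and iota_add: "\<lbrakk>x \<in> carrier M; y \<in> carrier M\<rbrakk> \<Longrightarrow> \<iota> (x \<oplus>\<^bsub>M\<^esub> y) = \<iota> x \<oplus>\<^bsub>T\<^esub> \<iota> y"
    and iota_rsmult: "\<lbrakk>x \<in> carrier M; r \<in> D \<one>\<rbrakk> \<Longrightarrow> \<iota> (x \<bullet>\<^bsub>M\<^esub> r) = \<iota> x \<bullet>\<^bsub>T\<^esub> r"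
    and iota_eq_zeroD: "\<lbrakk>x \<in> carrier M; \<iota> x = \<zero>\<^bsub>T\<^esub>\<rbrakk> \<Longrightarrow> x = \<zero>\<^bsub>M\<^esub>"
    and proj_one_image: "t \<in> carrier T \<Longrightarrow> proj \<one> t \<in> \<iota> ` carrier M"
    and proj_one_iota: "x \<in> carrier M \<Longrightarrow> proj \<one> (\<iota> x) = \<iota> x"
begin

section \<open>The base module as identity component\<close>

lemma M_rsmult_closed [simp]: "\<lbrakk>x \<in> carrier M; r \<in> D \<one>\<rbrakk> \<Longrightarrow> x \<bullet>\<^bsub>M\<^esub> r \<in> carrier M"
  using M.rsmult_closed by simp

lemma iota_zero [simp]: "\<iota> \<zero>\<^bsub>M\<^esub> = \<zero>\<^bsub>T\<^esub>"
proof -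
  have "\<iota> \<zero>\<^bsub>M\<^esub> = \<iota> (\<zero>\<^bsub>M\<^esub> \<bullet>\<^bsub>M\<^esub> \<zero>\<^bsub>S\<^esub>)"
    using M.rsmult_zero[OF M.M.zero_closed] by simp
  also have "\<dots> = \<zero>\<^bsub>T\<^esub>"
    by (subst iota_rsmult) simp_all
  finally show ?thesis .
qed

lemma iota_minus:
  assumes "x \<in> carrier M"
  shows "\<iota> (\<ominus>\<^bsub>M\<^esub> x) = \<ominus>\<^bsub>T\<^esub> \<iota> x"
  using assms iota_add[of "\<ominus>\<^bsub>M\<^esub> x" x] by (simp add: M.M.l_neg T.M.minus_equality)

lemma iota_inj:
  assumes "x \<in> carrier M" "y \<in> carrier M" "\<iota> x = \<iota> y"
  shows "x = y"
proof -
  have "\<iota> (x \<ominus>\<^bsub>M\<^esub> y) = \<zero>\<^bsub>T\<^esub>"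
    using assms by (simp add: M.M.minus_eq iota_add iota_minus T.M.r_neg)
  then have "x \<ominus>\<^bsub>M\<^esub> y = \<zero>\<^bsub>M\<^esub>"
    using assms iota_eq_zeroD by simp
  then show ?thesis
    using assms M.M.add.inv_solve_right'[of "\<zero>\<^bsub>M\<^esub>" x y] by (simp add: M.M.minus_eq)
qed

lemma proj_iota:
  "\<lbrakk>g \<in> carrier G; x \<in> carrier M\<rbrakk> \<Longrightarrow> proj g (\<iota> x) = (if g = \<one> then \<iota> x else \<zero>\<^bsub>T\<^esub>)"
  using proj_proj[of g \<one> "\<iota> x"] by (auto simp: proj_one_iota)

lemma proj_iota_rsmult:
  "\<lbrakk>g \<in> carrier G; a \<in> D g; x \<in> carrier M\<rbrakk> \<Longrightarrow> proj g (\<iota> x \<bullet>\<^bsub>T\<^esub> a) = \<iota> x \<bullet>\<^bsub>T\<^esub> a"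
  using proj_rsmult[of \<one> g "\<iota> x" a] by (simp add: proj_iota)

text \<open>The product has degree \<open>e\<close>, and the identity component is the image of
  \<open>M\<close>.\<close>

lemma proj_rsmult_image:
  assumes "g \<in> carrier G" "t \<in> carrier T" "c \<in> D (inv g)"
  shows "proj g t \<bullet>\<^bsub>T\<^esub> c \<in> \<iota> ` carrier M"
proof -
  have "c \<in> carrier S" using assms component_set_closed(1)[of "inv g"] by simp
  then show ?thesis
    using proj_rsmult[of g "inv g" t c] proj_one_image[of "t \<bullet>\<^bsub>T\<^esub> c"] assms by simp
qed

text \<open>
  \<open>span_ann N\<close> is the annihilator of the submodule \<open>NS\<close>, but it depends only on the
  annihilator of \<open>N\<close> in the base ring.
\<close>

definition span_ann :: "_ set \<Rightarrow> _ set" where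
  "span_ann N = {s \<in> carrier S. \<forall>x\<in>N. \<forall>a\<in>carrier S. (\<iota> x \<bullet>\<^bsub>T\<^esub> a) \<bullet>\<^bsub>T\<^esub> s = \<zero>\<^bsub>T\<^esub>}"

text \<open>If \<open>NSr = 0\<close>, then \<open>S_{g^-1} r S_g\<close> lies in \<open>J\<close>,
  and multiplying by \<open>S_g\<close> on the left and \<open>S_{g^-1}\<close> on the right
  recovers \<open>r\<close> as an element of \<open>J^g\<close>. Conversely, for \<open>a\<close> of
  degree \<open>g\<close> the set \<open>a J^{g^-1}\<close> lies in
  \<open>(a S_{g^-1}) J S_g\<close>, where \<open>a S_{g^-1}\<close> lies in \<open>R\<close> and
  hence maps \<open>N\<close> into itself, and \<open>J\<close> kills \<open>N\<close>.\<close>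

lemma span_ann_base:
  assumes N: "right_submodule N (base_ring G S D) M" and r: "r \<in> D \<one>"
  shows "r \<in> span_ann N \<longleftrightarrow>
    r \<in> core_ideal G S D (annihilator (base_ring G S D) (M\<lparr>carrier := N\<rparr>))"
    (is "_ \<longleftrightarrow> r \<in> core_ideal G S D ?J")
proof
  interpret N: right_submodule N "base_ring G S D" M by fact
  have N_mem: "x \<bullet>\<^bsub>M\<^esub> a \<in> N" if "x \<in> N" "a \<in> D \<one>" for x a
    using that N.rsmult_mem by simp
  have J: "?J = {a \<in> D \<one>. \<forall>x\<in>N. x \<bullet>\<^bsub>M\<^esub> a = \<zero>\<^bsub>M\<^esub>}"
    by (simp add: annihilator_def)
  note closed = component_set_closed(1)
  have rS: "r \<in> carrier S" using r closed by blast
  show "r \<in> core_ideal G S D ?J" if ann: "r \<in> span_ann N"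
    unfolding core_ideal_def
  proof
    fix g assume g: "g \<in> carrier G"
    then have g': "inv g \<in> carrier G" by simp
    have inner: "(q \<otimes>\<^bsub>S\<^esub> r) \<otimes>\<^bsub>S\<^esub> p \<in> ?J" if q: "q \<in> D (inv g)" and p: "p \<in> D g" for p q
    proof -
      have [simp]: "q \<in> carrier S" "p \<in> carrier S" using p q closed[OF g] closed[OF g'] by auto
      have "q \<otimes>\<^bsub>S\<^esub> r \<in> D (inv g)"
        using component_set_mult[OF g' G.one_closed q r] g by simp
      then have base: "q \<otimes>\<^bsub>S\<^esub> r \<otimes>\<^bsub>S\<^esub> p \<in> D \<one>"
        using component_set_mult[OF g' g _ p] g by force
      have "x \<bullet>\<^bsub>M\<^esub> (q \<otimes>\<^bsub>S\<^esub> r \<otimes>\<^bsub>S\<^esub> p) = \<zero>\<^bsub>M\<^esub>" if x: "x \<in> N" for x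
      proof (rule iota_eq_zeroD)
        have xM: "x \<in> carrier M" using x N.a_subset by blast
        then show "x \<bullet>\<^bsub>M\<^esub> (q \<otimes>\<^bsub>S\<^esub> r \<otimes>\<^bsub>S\<^esub> p) \<in> carrier M"
          using base by simp
        have "\<iota> x \<bullet>\<^bsub>T\<^esub> q \<bullet>\<^bsub>T\<^esub> r = \<zero>\<^bsub>T\<^esub>"
          using ann x unfolding span_ann_def by simp
        then show "\<iota> (x \<bullet>\<^bsub>M\<^esub> (q \<otimes>\<^bsub>S\<^esub> r \<otimes>\<^bsub>S\<^esub> p)) = \<zero>\<^bsub>T\<^esub>"
          using xM rS base by (simp add: iota_rsmult T.rsmult_assoc)
      qed
      then show ?thesis using base by (simp add: J)
    qed
    have conj: "(p \<otimes>\<^bsub>S\<^esub> q \<otimes>\<^bsub>S\<^esub> r) \<otimes>\<^bsub>S\<^esub> (p' \<otimes>\<^bsub>S\<^esub> q') \<in> conj_ideal G S D ?J g"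
      if "p \<in> D g" "q \<in> D (inv g)" "p' \<in> D g" "q' \<in> D (inv g)" for p q p' q'
    proof -
      have "(p \<otimes>\<^bsub>S\<^esub> (q \<otimes>\<^bsub>S\<^esub> r \<otimes>\<^bsub>S\<^esub> p')) \<otimes>\<^bsub>S\<^esub> q' \<in> conj_ideal G S D ?J g"
        unfolding conj_ideal_def using inner that by (intro ideal_prod.prod) auto
      then show ?thesis
        using that rS closed[OF g] closed[OF g'] by (simp add: S.m_assoc)
    qed
    have conj_add: "a \<oplus>\<^bsub>S\<^esub> b \<in> conj_ideal G S D ?J g"
      if "a \<in> conj_ideal G S D ?J g" "b \<in> conj_ideal G S D ?J g" for a b
      using that unfolding conj_ideal_def by (rule ideal_prod.sum)
    \<comment> \<open>The unit is inserted next to \<open>r\<close> one side at a time. Here the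
      left factor \<open>w\<close> varies and is then taken to be 1; the inclusion after it does the
      same on the right.\<close>
    have left: "D g \<cdot>\<^bsub>S\<^esub> D (inv g) \<subseteq>
      {w \<in> carrier S. \<forall>p\<in>D g. \<forall>q\<in>D (inv g). (w \<otimes>\<^bsub>S\<^esub> r) \<otimes>\<^bsub>S\<^esub> (p \<otimes>\<^bsub>S\<^esub> q) \<in> conj_ideal G S D ?J g}"
      using rS closed[OF g] closed[OF g'] conj
      by (intro ideal_prod_subsetI) (auto simp: S.l_distr intro!: conj_add)
    have "D g \<cdot>\<^bsub>S\<^esub> D (inv g) \<subseteq> {w \<in> carrier S. r \<otimes>\<^bsub>S\<^esub> w \<in> conj_ideal G S D ?J g}"
      using rS closed[OF g] closed[OF g'] subsetD[OF left one_mem_prod(1)[OF g]]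
      by (intro ideal_prod_subsetI) (auto simp: S.r_distr intro!: conj_add)
    from subsetD[OF this one_mem_prod(1)[OF g]]
    show "r \<in> conj_ideal G S D ?J g" using rS by simp
  qed
  show "r \<in> span_ann N" if core: "r \<in> core_ideal G S D ?J"
    unfolding span_ann_def
  proof (intro CollectI conjI rS ballI)
    fix x a assume x: "x \<in> N" and a: "a \<in> carrier S"
    have xM: "x \<in> carrier M" using x N.a_subset by blast
    show "(\<iota> x \<bullet>\<^bsub>T\<^esub> a) \<bullet>\<^bsub>T\<^esub> r = \<zero>\<^bsub>T\<^esub>"
      using a
    proof (induction rule: homogeneous_induct)
      case (homogeneous g a)
      then have g': "inv g \<in> carrier G" by simp
      have a: "a \<in> carrier S" using homogeneous closed by blast
      let ?K = "{w \<in> carrier S. (\<iota> x \<bullet>\<^bsub>T\<^esub> a) \<bullet>\<^bsub>T\<^esub> w = \<zero>\<^bsub>T\<^esub>}"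
      have K_add: "b \<oplus>\<^bsub>S\<^esub> c \<in> ?K" if "b \<in> ?K" "c \<in> ?K" for b c
        using that xM a by (auto simp: T.rsmult_r_distr)
      have "D (inv g) \<cdot>\<^bsub>S\<^esub> ?J \<subseteq> ?K"
      proof (rule ideal_prod_subsetI)
        fix b j assume b: "b \<in> D (inv g)" and j: "j \<in> ?J"
        have S: "b \<in> carrier S" "j \<in> carrier S" "j \<in> D \<one>" using b j closed[OF g'] closed[OF G.one_closed] by (auto simp: J)
        have ab: "a \<otimes>\<^bsub>S\<^esub> b \<in> D \<one>"
          using component_set_mult[OF homogeneous(1) g' homogeneous(2) b] homogeneous by simp
        have "(\<iota> x \<bullet>\<^bsub>T\<^esub> a) \<bullet>\<^bsub>T\<^esub> (b \<otimes>\<^bsub>S\<^esub> j) = (\<iota> x \<bullet>\<^bsub>T\<^esub> (a \<otimes>\<^bsub>S\<^esub> b)) \<bullet>\<^bsub>T\<^esub> j"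
          using xM a S by (simp add: T.rsmult_assoc)
        also have "\<dots> = \<iota> ((x \<bullet>\<^bsub>M\<^esub> (a \<otimes>\<^bsub>S\<^esub> b)) \<bullet>\<^bsub>M\<^esub> j)"
          using xM ab S by (simp add: iota_rsmult)
        also have "\<dots> = \<zero>\<^bsub>T\<^esub>"
          using N_mem[OF x ab] j by (simp add: J)
        finally show "b \<otimes>\<^bsub>S\<^esub> j \<in> ?K" using S by simp
      qed (rule K_add)
      then have "conj_ideal G S D ?J (inv g) \<subseteq> ?K"
        unfolding conj_ideal_def using homogeneous xM a closed[of g]
        by (intro ideal_prod_subsetI K_add) (auto simp: T.rsmult_assoc subset_iff)
      then show ?case using core g' unfolding core_ideal_def by blast
    qed (use xM rS in \<open>auto simp: T.rsmult_r_distr T.rsmult_l_distr\<close>)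
  qed
qed

lemma core_ideal_subset:
  assumes "J \<subseteq> D \<one>"
  shows "core_ideal G S D J \<subseteq> D \<one>"
proof -
  have "D \<one> \<cdot>\<^bsub>S\<^esub> J \<subseteq> D \<one>"
    using assms component_set_mult[of \<one> \<one>] by (intro ideal_prod_subsetI) auto
  then have "conj_ideal G S D J \<one> \<subseteq> D \<one>"
    unfolding conj_ideal_def using component_set_mult[of \<one> \<one>] by (intro ideal_prod_subsetI) auto
  then show ?thesis unfolding core_ideal_def by blast
qed

lemma span_ann_add:
  assumes "N \<subseteq> carrier M" "a \<in> span_ann N" "b \<in> span_ann N"
  shows "a \<oplus>\<^bsub>S\<^esub> b \<in> span_ann N"
  using assms by (auto simp: span_ann_def T.rsmult_r_distr subset_iff)

lemma span_ann_mult: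
  assumes "N \<subseteq> carrier M" "a \<in> span_ann N" "b \<in> carrier S"
  shows "a \<otimes>\<^bsub>S\<^esub> b \<in> span_ann N"
  using assms by (auto simp: span_ann_def T.rsmult_assoc subset_iff)

text \<open>The annihilator of a graded submodule is graded: for \<open>a\<close> of degree
  \<open>g\<close>, the degree \<open>gh\<close> part of \<open>(xa)s = 0\<close> is
  \<open>(xa)s_h\<close>.\<close>

lemma span_ann_component:
  assumes "N \<subseteq> carrier M" "s \<in> span_ann N" "h \<in> carrier G"
  shows "component h s \<in> span_ann N"
proof -
  have s: "s \<in> carrier S" using assms by (simp add: span_ann_def)
  have "(\<iota> x \<bullet>\<^bsub>T\<^esub> a) \<bullet>\<^bsub>T\<^esub> component h s = \<zero>\<^bsub>T\<^esub>" if x: "x \<in> N" and a: "a \<in> carrier S" for x a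
    using a
  proof (induction rule: homogeneous_induct)
    case (homogeneous g a)
    have "a \<in> carrier S" using homogeneous component_set_closed(1) by blast
    moreover have "x \<in> carrier M" using x assms by blast
    ultimately have "(\<iota> x \<bullet>\<^bsub>T\<^esub> a) \<bullet>\<^bsub>T\<^esub> component h s = proj (g \<otimes> h) ((\<iota> x \<bullet>\<^bsub>T\<^esub> a) \<bullet>\<^bsub>T\<^esub> s)"
      using proj_rsmult_component[of g h "\<iota> x \<bullet>\<^bsub>T\<^esub> a" s] homogeneous assms s
      by (simp add: proj_iota_rsmult)
    also have "\<dots> = \<zero>\<^bsub>T\<^esub>"
      using assms x \<open>a \<in> carrier S\<close> homogeneous by (simp add: span_ann_def)
    finally show ?case .
  qed (use assms x s in \<open>auto simp: T.rsmult_r_distr T.rsmult_l_distr subset_iff\<close>)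
  then show ?thesis using assms s by (simp add: span_ann_def)
qed

text \<open>A graded right ideal \<open>I\<close> satisfies \<open>I_h = I_h S_{h^-1} S_h\<close>,
  and \<open>I_h S_{h^-1}\<close> lies in \<open>I_e\<close>; hence \<open>I = I_e S\<close>. The
  degree \<open>e\<close> part is supplied by \<open>span_ann_base\<close>.\<close>

lemma span_ann_eq:
  assumes N: "right_submodule N (base_ring G S D) M"
  shows "span_ann N =
    core_ideal G S D (annihilator (base_ring G S D) (M\<lparr>carrier := N\<rparr>)) \<cdot>\<^bsub>S\<^esub> carrier S"
    (is "_ = ?C \<cdot>\<^bsub>S\<^esub> carrier S")
proof
  interpret N: right_submodule N "base_ring G S D" M by fact
  have C: "?C \<subseteq> D \<one>" by (rule core_ideal_subset) (auto simp: annihilator_def)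
  show "?C \<cdot>\<^bsub>S\<^esub> carrier S \<subseteq> span_ann N"
    using C span_ann_base[OF N] span_ann_mult[OF N.a_subset] span_ann_add[OF N.a_subset]
    by (intro ideal_prod_subsetI) blast+
  show "span_ann N \<subseteq> ?C \<cdot>\<^bsub>S\<^esub> carrier S"
  proof
    fix s assume ann: "s \<in> span_ann N"
    then have s: "s \<in> carrier S" by (simp add: span_ann_def)
    then show "s \<in> ?C \<cdot>\<^bsub>S\<^esub> carrier S"
    proof (rule component_induct)
      have "\<zero>\<^bsub>S\<^esub> \<in> ?C"
        using span_ann_base[OF N, of "\<zero>\<^bsub>S\<^esub>"] N.a_subset by (auto simp: span_ann_def subset_iff)
      then show "\<zero>\<^bsub>S\<^esub> \<in> ?C \<cdot>\<^bsub>S\<^esub> carrier S"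
        using ideal_prod.prod[of "\<zero>\<^bsub>S\<^esub>" ?C "\<zero>\<^bsub>S\<^esub>" "carrier S" S] by simp
    next
      fix h assume h: "h \<in> carrier G"
      let ?s = "component h s"
      have "?s \<in> span_ann N" using ann h N.a_subset by (intro span_ann_component)
      have "D (inv h) \<cdot>\<^bsub>S\<^esub> D h \<subseteq> {w \<in> carrier S. ?s \<otimes>\<^bsub>S\<^esub> w \<in> ?C \<cdot>\<^bsub>S\<^esub> carrier S}"
      proof (rule ideal_prod_subsetI)
        fix b c assume b: "b \<in> D (inv h)" and c: "c \<in> D h"
        have [simp]: "b \<in> carrier S" "c \<in> carrier S"
          using b c h component_set_closed(1)[of h] component_set_closed(1)[of "inv h"] by auto
        have "?s \<otimes>\<^bsub>S\<^esub> b \<in> D \<one>"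
          using component_set_mult[of h "inv h" ?s b] h s b by simp
        moreover have "?s \<otimes>\<^bsub>S\<^esub> b \<in> span_ann N"
          using \<open>?s \<in> span_ann N\<close> N.a_subset by (intro span_ann_mult) simp_all
        ultimately have "?s \<otimes>\<^bsub>S\<^esub> b \<in> ?C" using span_ann_base[OF N] by blast
        then have "(?s \<otimes>\<^bsub>S\<^esub> b) \<otimes>\<^bsub>S\<^esub> c \<in> ?C \<cdot>\<^bsub>S\<^esub> carrier S" by (rule ideal_prod.prod) simp
        then show "b \<otimes>\<^bsub>S\<^esub> c \<in> {w \<in> carrier S. ?s \<otimes>\<^bsub>S\<^esub> w \<in> ?C \<cdot>\<^bsub>S\<^esub> carrier S}"
          using h s by (simp add: S.m_assoc)
      qed (use h s in \<open>auto simp: S.r_distr intro: ideal_prod.sum\<close>)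
      from subsetD[OF this one_mem_prod(2)[OF h]]
      show "?s \<in> ?C \<cdot>\<^bsub>S\<^esub> carrier S" using h s by simp
    qed (rule ideal_prod.sum)
  qed
qed

text \<open>The submodule \<open>LS\<close>, described by its homogeneous components.\<close>

definition graded_span :: "_ set \<Rightarrow> _ set" where
  "graded_span L = {t \<in> carrier T. \<forall>g\<in>carrier G. \<forall>c\<in>D (inv g). proj g t \<bullet>\<^bsub>T\<^esub> c \<in> \<iota> ` L}"

lemma graded_spanD:
  "\<lbrakk>t \<in> graded_span L; g \<in> carrier G; c \<in> D (inv g)\<rbrakk> \<Longrightarrow> proj g t \<bullet>\<^bsub>T\<^esub> c \<in> \<iota> ` L"
  unfolding graded_span_def by blast

text \<open>Makes primeness of a whole tensor product an instance of primeness of a graded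
  span.\<close>

lemma graded_span_carrier: "graded_span (carrier M) = carrier T"
  using proj_rsmult_image by (auto simp: graded_span_def)

lemma iota_mem_graded_span:
  assumes L: "right_submodule L (base_ring G S D) M" and x: "x \<in> L"
  shows "\<iota> x \<in> graded_span L"
proof -
  interpret L: right_submodule L "base_ring G S D" M by fact
  have xM: "x \<in> carrier M" using x L.a_subset by blast
  have "proj g (\<iota> x) \<bullet>\<^bsub>T\<^esub> c \<in> \<iota> ` L" if g: "g \<in> carrier G" and c: "c \<in> D (inv g)" for g c
  proof (cases "g = \<one>")
    case True
    then have "proj g (\<iota> x) \<bullet>\<^bsub>T\<^esub> c = \<iota> (x \<bullet>\<^bsub>M\<^esub> c)" "x \<bullet>\<^bsub>M\<^esub> c \<in> L"
      using xM c L.rsmult_mem[OF x] by (simp_all add: proj_iota iota_rsmult)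
    then show ?thesis by simp
  next
    case False
    moreover have "c \<in> carrier S" using g c component_set_closed(1)[of "inv g"] by simp
    ultimately have "proj g (\<iota> x) \<bullet>\<^bsub>T\<^esub> c = \<iota> \<zero>\<^bsub>M\<^esub>"
      using xM g by (simp add: proj_iota)
    then show ?thesis using L.zero_closed by (metis image_eqI)
  qed
  then show ?thesis using xM by (simp add: graded_span_def)
qed

lemma right_submodule_graded_span:
  assumes L: "right_submodule L (base_ring G S D) M"
  shows "right_submodule (graded_span L) S T"
proof (rule T.right_submoduleI)
  interpret L: right_submodule L "base_ring G S D" M by fact
  have image_add: "a \<oplus>\<^bsub>T\<^esub> b \<in> \<iota> ` L" if ab: "a \<in> \<iota> ` L" "b \<in> \<iota> ` L" for a b
  proof -
    obtain x y where xy: "x \<in> L" "y \<in> L" "a = \<iota> x" "b = \<iota> y" using ab by blast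
    then have "a \<oplus>\<^bsub>T\<^esub> b = \<iota> (x \<oplus>\<^bsub>M\<^esub> y)"
      using L.a_subset iota_add[of x y] by auto
    then show ?thesis using xy by blast
  qed
  show "graded_span L \<subseteq> carrier T" by (auto simp: graded_span_def)
  show "\<zero>\<^bsub>T\<^esub> \<in> graded_span L"
    using iota_mem_graded_span[OF L L.zero_closed] by simp
  show add: "t \<oplus>\<^bsub>T\<^esub> u \<in> graded_span L" if "t \<in> graded_span L" "u \<in> graded_span L" for t u
  proof -
    have "proj g (t \<oplus>\<^bsub>T\<^esub> u) \<bullet>\<^bsub>T\<^esub> c \<in> \<iota> ` L" if g: "g \<in> carrier G" and c: "c \<in> D (inv g)" for g c
    proof -
      have "c \<in> carrier S" using g c component_set_closed(1)[of "inv g"] by simp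
      then have "proj g (t \<oplus>\<^bsub>T\<^esub> u) \<bullet>\<^bsub>T\<^esub> c = proj g t \<bullet>\<^bsub>T\<^esub> c \<oplus>\<^bsub>T\<^esub> proj g u \<bullet>\<^bsub>T\<^esub> c"
        using \<open>t \<in> _\<close> \<open>u \<in> _\<close> g by (simp add: graded_span_def proj_add T.rsmult_l_distr)
      then show ?thesis
        using \<open>t \<in> _\<close> \<open>u \<in> _\<close> g c image_add by (simp add: graded_span_def)
    qed
    then show ?thesis using that by (simp add: graded_span_def)
  qed
  show "t \<bullet>\<^bsub>T\<^esub> a \<in> graded_span L" if t: "t \<in> graded_span L" and a: "a \<in> carrier S" for t a
    using a
  proof (induction rule: homogeneous_induct)
    case zero
    then show ?case using t \<open>\<zero>\<^bsub>T\<^esub> \<in> graded_span L\<close> by (simp add: graded_span_def)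
  next
    case (homogeneous h a)
    have tT: "t \<in> carrier T" using t by (simp add: graded_span_def)
    have a: "a \<in> carrier S" using homogeneous component_set_closed(1) by blast
    have "proj g (t \<bullet>\<^bsub>T\<^esub> a) \<bullet>\<^bsub>T\<^esub> c \<in> \<iota> ` L" if g: "g \<in> carrier G" and c: "c \<in> D (inv g)" for g c
    proof -
      have cS: "c \<in> carrier S" using g c component_set_closed(1)[of "inv g"] by simp
      \<comment> \<open>The factor \<open>ac\<close> has degree \<open>hg^-1\<close>, the inverse of
        \<open>gh^-1\<close>, so it is one of the scalars against which the component of
        \<open>t\<close> at \<open>gh^-1\<close> is tested.\<close>
      have "proj g (t \<bullet>\<^bsub>T\<^esub> a) \<bullet>\<^bsub>T\<^esub> c = proj (g \<otimes> inv h) t \<bullet>\<^bsub>T\<^esub> (a \<otimes>\<^bsub>S\<^esub> c)"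
        using tT a cS g homogeneous by (simp add: proj_rsmult' T.rsmult_assoc)
      moreover have "a \<otimes>\<^bsub>S\<^esub> c \<in> D (inv (g \<otimes> inv h))"
        using component_set_mult[of h "inv g" a c] homogeneous g c by (simp add: G.inv_mult_group)
      ultimately show ?thesis
        using t g homogeneous by (simp add: graded_span_def)
    qed
    then show ?case using tT a by (simp add: graded_span_def)
  next
    case (add a b)
    moreover have "t \<in> carrier T" using t by (simp add: graded_span_def)
    ultimately show ?case using \<open>\<And>t u. \<lbrakk>t \<in> graded_span L; u \<in> graded_span L\<rbrakk> \<Longrightarrow> _\<close>
      by (simp add: T.rsmult_r_distr)
  qed
qed

text \<open>A component \<open>t_g\<close> is a sum of products \<open>(t_g b)c\<close> with
  \<open>b\<close> of degree \<open>g^-1\<close> and \<open>c\<close> of degree \<open>g\<close>.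
  Each \<open>t_g b\<close> comes from \<open>L\<close>, so whatever kills all \<open>xa\<close>
  with \<open>x\<close> in \<open>L\<close> also kills \<open>t\<close>.\<close>

lemma annihilator_graded_span:
  assumes L: "right_submodule L (base_ring G S D) M"
  shows "annihilator S (T\<lparr>carrier := graded_span L\<rparr>) = span_ann L"
proof
  interpret span: right_submodule "graded_span L" S T
    using L by (rule right_submodule_graded_span)
  have "\<iota> x \<bullet>\<^bsub>T\<^esub> a \<in> graded_span L" if "x \<in> L" "a \<in> carrier S" for x a
    using span.rsmult_mem iota_mem_graded_span[OF L] that by blast
  then show "annihilator S (T\<lparr>carrier := graded_span L\<rparr>) \<subseteq> span_ann L"
    by (simp add: annihilator_def span_ann_def subset_iff)
  show "span_ann L \<subseteq> annihilator S (T\<lparr>carrier := graded_span L\<rparr>)"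
  proof
    fix s assume ann: "s \<in> span_ann L"
    then have s: "s \<in> carrier S" by (simp add: span_ann_def)
    note kernel = additive_subgroup_kernel[OF s]
    have "t \<bullet>\<^bsub>T\<^esub> s = \<zero>\<^bsub>T\<^esub>" if t: "t \<in> graded_span L" for t
    proof -
      have tT: "t \<in> carrier T" using t span.a_subset by blast
      have "t \<in> {t \<in> carrier T. t \<bullet>\<^bsub>T\<^esub> s = \<zero>\<^bsub>T\<^esub>}"
      proof (rule proj_span[OF tT kernel])
        fix g assume g: "g \<in> carrier G"
        show "proj g t \<in> {t \<in> carrier T. t \<bullet>\<^bsub>T\<^esub> s = \<zero>\<^bsub>T\<^esub>}"
        proof (rule mem_of_prod[OF g proj_closed[OF g tT] kernel])
          fix b c assume b: "b \<in> D (inv g)" and c: "c \<in> D g"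
          have bc: "b \<in> carrier S" "c \<in> carrier S"
            using b c g component_set_closed(1)[of "inv g"] component_set_closed(1)[of g] by auto
          obtain x where x: "x \<in> L" "proj g t \<bullet>\<^bsub>T\<^esub> b = \<iota> x"
            using graded_spanD[OF t g b] by (metis imageE)
          have "\<iota> x \<bullet>\<^bsub>T\<^esub> c \<bullet>\<^bsub>T\<^esub> s = \<zero>\<^bsub>T\<^esub>"
            using ann x(1) bc by (simp add: span_ann_def)
          then have "proj g t \<bullet>\<^bsub>T\<^esub> b \<bullet>\<^bsub>T\<^esub> c \<bullet>\<^bsub>T\<^esub> s = \<zero>\<^bsub>T\<^esub>"
            by (simp only: x(2))
          then show "proj g t \<bullet>\<^bsub>T\<^esub> b \<bullet>\<^bsub>T\<^esub> c \<in> {t \<in> carrier T. t \<bullet>\<^bsub>T\<^esub> s = \<zero>\<^bsub>T\<^esub>}"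
            using tT g bc by simp
        qed
      qed
      then show ?thesis by simp
    qed
    then show "s \<in> annihilator S (T\<lparr>carrier := graded_span L\<rparr>)"
      using s by (simp add: annihilator_def)
  qed
qed

text \<open>
  By minimal support the cyclic module \<open>uS\<close> is isomorphic to the graded module generated by a
  component of \<open>u\<close>, which is \<open>NS\<close> for a submodule \<open>N\<close> of \<open>M\<close>.
\<close>

lemma submodule_contains_graded_copy:
  assumes up: "unique_product_group G" and U: "right_submodule U S T" "U \<noteq> {\<zero>\<^bsub>T\<^esub>}"
  obtains N u g where
    "right_submodule N (base_ring G S D) M" "N \<noteq> {\<zero>\<^bsub>M\<^esub>}"
    "u \<in> U" "u \<noteq> \<zero>\<^bsub>T\<^esub>" "g \<in> carrier G"
    "span_ann N = {s \<in> carrier S. \<forall>a\<in>carrier S. (u \<bullet>\<^bsub>T\<^esub> a) \<bullet>\<^bsub>T\<^esub> s = \<zero>\<^bsub>T\<^esub>}"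
    "\<forall>x\<in>N. \<exists>c\<in>D (inv g). \<iota> x = proj g u \<bullet>\<^bsub>T\<^esub> c"
    "\<forall>x\<in>N - {\<zero>\<^bsub>M\<^esub>}. \<exists>b\<in>carrier S. u \<bullet>\<^bsub>T\<^esub> b \<noteq> \<zero>\<^bsub>T\<^esub> \<and>
       (\<forall>s\<in>carrier S. \<forall>a\<in>carrier S.
          (u \<bullet>\<^bsub>T\<^esub> b) \<bullet>\<^bsub>T\<^esub> a \<bullet>\<^bsub>T\<^esub> s = \<zero>\<^bsub>T\<^esub> \<longleftrightarrow> (\<iota> x \<bullet>\<^bsub>T\<^esub> a) \<bullet>\<^bsub>T\<^esub> s = \<zero>\<^bsub>T\<^esub>)"
proof -
  interpret U: right_submodule U S T by fact
  obtain u g where u: "u \<in> U" and g: "g \<in> carrier G" and nz: "proj g u \<noteq> \<zero>\<^bsub>T\<^esub>"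
    and iff: "\<And>s. s \<in> carrier S \<Longrightarrow> u \<bullet>\<^bsub>T\<^esub> s = \<zero>\<^bsub>T\<^esub> \<longleftrightarrow> proj g u \<bullet>\<^bsub>T\<^esub> s = \<zero>\<^bsub>T\<^esub>"
    using minimal_support[OF up U] by blast
  have uT [simp]: "u \<in> carrier T" using u U.a_subset by blast
  have pT [simp]: "proj g u \<in> carrier T" using g by simp
  have u_nz: "u \<noteq> \<zero>\<^bsub>T\<^esub>" using nz g by auto
  note closed = component_set_closed(1)[of "inv g"] component_set_closed(1)[of g]
  \<comment> \<open>The degree \<open>e\<close> part of \<open>u_g S\<close> is
    \<open>u_g S_{g^-1}\<close>; \<open>N\<close> is its preimage in \<open>M\<close>.\<close>
  define N where "N = {x \<in> carrier M. \<exists>c\<in>D (inv g). \<iota> x = proj g u \<bullet>\<^bsub>T\<^esub> c}"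
  have N_iff: "x \<in> N \<longleftrightarrow> x \<in> carrier M \<and> (\<exists>c\<in>D (inv g). \<iota> x = proj g u \<bullet>\<^bsub>T\<^esub> c)" for x
    by (simp add: N_def)
  have N_ex: "\<exists>x\<in>N. \<iota> x = proj g u \<bullet>\<^bsub>T\<^esub> c" if "c \<in> D (inv g)" for c
    using proj_rsmult_image[OF g uT that] that N_iff by (metis imageE)
  have N: "right_submodule N (base_ring G S D) M"
  proof (rule M.right_submoduleI)
    show "\<zero>\<^bsub>M\<^esub> \<in> N"
      using g by (auto simp: N_iff intro!: bexI[of _ "\<zero>\<^bsub>S\<^esub>"])
    fix x assume x: "x \<in> N"
    then obtain c where c: "x \<in> carrier M" "c \<in> D (inv g)" "\<iota> x = proj g u \<bullet>\<^bsub>T\<^esub> c"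
      by (auto simp: N_iff)
    have cS: "c \<in> carrier S" using c g closed by simp
    show "x \<oplus>\<^bsub>M\<^esub> y \<in> N" if y: "y \<in> N" for y
    proof -
      obtain d where d: "y \<in> carrier M" "d \<in> D (inv g)" "\<iota> y = proj g u \<bullet>\<^bsub>T\<^esub> d"
        using y by (auto simp: N_iff)
      have "\<iota> (x \<oplus>\<^bsub>M\<^esub> y) = proj g u \<bullet>\<^bsub>T\<^esub> (c \<oplus>\<^bsub>S\<^esub> d)"
        using c d g cS closed by (simp add: iota_add T.rsmult_r_distr)
      moreover have "c \<oplus>\<^bsub>S\<^esub> d \<in> D (inv g)" using c d g by simp
      ultimately show ?thesis using c d by (auto simp: N_iff)
    qed
    show "x \<bullet>\<^bsub>M\<^esub> r \<in> N" if r: "r \<in> carrier (base_ring G S D)" for r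
    proof -
      have r': "r \<in> D \<one>" "r \<in> carrier S" using r component_set_closed(1)[OF G.one_closed] by auto
      then have "\<iota> (x \<bullet>\<^bsub>M\<^esub> r) = proj g u \<bullet>\<^bsub>T\<^esub> (c \<otimes>\<^bsub>S\<^esub> r)"
        using c cS by (simp add: iota_rsmult T.rsmult_assoc)
      moreover have "c \<otimes>\<^bsub>S\<^esub> r \<in> D (inv g)"
        using component_set_mult[of "inv g" \<one> c r] c g r' by simp
      ultimately show ?thesis using c r' by (auto simp: N_iff)
    qed
  qed (auto simp: N_def)
  \<comment> \<open>If \<open>N\<close> were zero, then \<open>u_g S_{g^-1} = 0\<close>, and
    multiplying by \<open>S_g\<close> would give \<open>u_g = 0\<close>.\<close>
  have "N \<noteq> {\<zero>\<^bsub>M\<^esub>}"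
  proof
    assume N0: "N = {\<zero>\<^bsub>M\<^esub>}"
    have "proj g u \<in> {t \<in> carrier T. t \<bullet>\<^bsub>T\<^esub> \<one>\<^bsub>S\<^esub> = \<zero>\<^bsub>T\<^esub>}"
    proof (rule mem_of_prod[OF g pT additive_subgroup_kernel[OF S.one_closed]])
      fix b c assume b: "b \<in> D (inv g)" and c: "c \<in> D g"
      have "proj g u \<bullet>\<^bsub>T\<^esub> b = \<zero>\<^bsub>T\<^esub>" using N_ex[OF b] N0 by auto
      then show "proj g u \<bullet>\<^bsub>T\<^esub> b \<bullet>\<^bsub>T\<^esub> c \<in> {t \<in> carrier T. t \<bullet>\<^bsub>T\<^esub> \<one>\<^bsub>S\<^esub> = \<zero>\<^bsub>T\<^esub>}"
        using c g closed by simp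
    qed
    then show False using nz T.rsmult_one by simp
  qed
  \<comment> \<open>\<open>NS = u_g S_{g^-1} S = u_g S\<close>, and \<open>iff\<close> exchanges
    \<open>u_g\<close> for \<open>u\<close>.\<close>
  moreover have "span_ann N = {s \<in> carrier S. \<forall>a\<in>carrier S. (u \<bullet>\<^bsub>T\<^esub> a) \<bullet>\<^bsub>T\<^esub> s = \<zero>\<^bsub>T\<^esub>}"
  proof (intro equalityI subsetI)
    fix s assume ann: "s \<in> span_ann N"
    then have s: "s \<in> carrier S" by (simp add: span_ann_def)
    have "u \<bullet>\<^bsub>T\<^esub> a \<bullet>\<^bsub>T\<^esub> s = \<zero>\<^bsub>T\<^esub>" if a: "a \<in> carrier S" for a
    proof -
      have as: "a \<otimes>\<^bsub>S\<^esub> s \<in> carrier S" using a s by simp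
      have "proj g u \<in> {t \<in> carrier T. t \<bullet>\<^bsub>T\<^esub> (a \<otimes>\<^bsub>S\<^esub> s) = \<zero>\<^bsub>T\<^esub>}"
      proof (rule mem_of_prod[OF g pT additive_subgroup_kernel[OF as]])
        fix b c assume b: "b \<in> D (inv g)" and c: "c \<in> D g"
        obtain x where x: "x \<in> N" "\<iota> x = proj g u \<bullet>\<^bsub>T\<^esub> b" using N_ex[OF b] by blast
        have bc: "b \<in> carrier S" "c \<in> carrier S" using b c g closed by auto
        have "\<iota> x \<bullet>\<^bsub>T\<^esub> (c \<otimes>\<^bsub>S\<^esub> a) \<bullet>\<^bsub>T\<^esub> s = \<zero>\<^bsub>T\<^esub>"
          using ann x(1) bc a by (simp add: span_ann_def)
        then show "proj g u \<bullet>\<^bsub>T\<^esub> b \<bullet>\<^bsub>T\<^esub> c \<in> {t \<in> carrier T. t \<bullet>\<^bsub>T\<^esub> (a \<otimes>\<^bsub>S\<^esub> s) = \<zero>\<^bsub>T\<^esub>}"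
          using bc a s by (simp add: x T.rsmult_assoc)
      qed
      then show ?thesis using iff[OF as] a s by (simp add: T.rsmult_assoc)
    qed
    then show "s \<in> {s \<in> carrier S. \<forall>a\<in>carrier S. (u \<bullet>\<^bsub>T\<^esub> a) \<bullet>\<^bsub>T\<^esub> s = \<zero>\<^bsub>T\<^esub>}" using s by simp
  next
    fix s assume "s \<in> {s \<in> carrier S. \<forall>a\<in>carrier S. (u \<bullet>\<^bsub>T\<^esub> a) \<bullet>\<^bsub>T\<^esub> s = \<zero>\<^bsub>T\<^esub>}"
    then have s: "s \<in> carrier S" and kill: "\<And>a. a \<in> carrier S \<Longrightarrow> u \<bullet>\<^bsub>T\<^esub> a \<bullet>\<^bsub>T\<^esub> s = \<zero>\<^bsub>T\<^esub>" by auto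
    have "\<iota> x \<bullet>\<^bsub>T\<^esub> a \<bullet>\<^bsub>T\<^esub> s = \<zero>\<^bsub>T\<^esub>" if "x \<in> N" and a: "a \<in> carrier S" for x a
    proof -
      obtain c where c: "c \<in> D (inv g)" "\<iota> x = proj g u \<bullet>\<^bsub>T\<^esub> c" using \<open>x \<in> N\<close> by (auto simp: N_iff)
      have cS: "c \<in> carrier S" using c g closed by simp
      have "u \<bullet>\<^bsub>T\<^esub> (c \<otimes>\<^bsub>S\<^esub> a \<otimes>\<^bsub>S\<^esub> s) = \<zero>\<^bsub>T\<^esub>"
        using kill[of "c \<otimes>\<^bsub>S\<^esub> a"] cS a s by (simp add: T.rsmult_assoc)
      then have "proj g u \<bullet>\<^bsub>T\<^esub> (c \<otimes>\<^bsub>S\<^esub> a \<otimes>\<^bsub>S\<^esub> s) = \<zero>\<^bsub>T\<^esub>"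
        using iff[of "c \<otimes>\<^bsub>S\<^esub> a \<otimes>\<^bsub>S\<^esub> s"] cS a s by simp
      then show ?thesis using cS a s by (simp add: c T.rsmult_assoc)
    qed
    then show "s \<in> span_ann N" using s by (simp add: span_ann_def)
  qed
  \<comment> \<open>Under the isomorphism of \<open>uS\<close> with \<open>u_g S\<close>, the
    element \<open>\<iota> x = u_g c\<close> corresponds to \<open>uc\<close>, so
    \<open>b = c\<close>. Only the equality of annihilation conditions is recorded.\<close>
  moreover have "\<exists>b\<in>carrier S. u \<bullet>\<^bsub>T\<^esub> b \<noteq> \<zero>\<^bsub>T\<^esub> \<and>
       (\<forall>s\<in>carrier S. \<forall>a\<in>carrier S.
          (u \<bullet>\<^bsub>T\<^esub> b) \<bullet>\<^bsub>T\<^esub> a \<bullet>\<^bsub>T\<^esub> s = \<zero>\<^bsub>T\<^esub> \<longleftrightarrow> (\<iota> x \<bullet>\<^bsub>T\<^esub> a) \<bullet>\<^bsub>T\<^esub> s = \<zero>\<^bsub>T\<^esub>)"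
    if x: "x \<in> N" "x \<noteq> \<zero>\<^bsub>M\<^esub>" for x
  proof -
    obtain c where c: "x \<in> carrier M" "c \<in> D (inv g)" "\<iota> x = proj g u \<bullet>\<^bsub>T\<^esub> c"
      using x by (auto simp: N_iff)
    have cS: "c \<in> carrier S" using c g closed by simp
    have "u \<bullet>\<^bsub>T\<^esub> c \<noteq> \<zero>\<^bsub>T\<^esub>" using iff[OF cS] c x iota_eq_zeroD by auto
    moreover have "(u \<bullet>\<^bsub>T\<^esub> c) \<bullet>\<^bsub>T\<^esub> a \<bullet>\<^bsub>T\<^esub> s = \<zero>\<^bsub>T\<^esub> \<longleftrightarrow> (\<iota> x \<bullet>\<^bsub>T\<^esub> a) \<bullet>\<^bsub>T\<^esub> s = \<zero>\<^bsub>T\<^esub>"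
      if "s \<in> carrier S" "a \<in> carrier S" for s a
      using iff[of "c \<otimes>\<^bsub>S\<^esub> a \<otimes>\<^bsub>S\<^esub> s"] that cS by (simp add: c T.rsmult_assoc)
    ultimately show ?thesis using cS by blast
  qed
  moreover have "\<forall>x\<in>N. \<exists>c\<in>D (inv g). \<iota> x = proj g u \<bullet>\<^bsub>T\<^esub> c"
    by (simp add: N_def)
  ultimately show thesis by (intro that[OF N _ u u_nz g]) auto
qed

text \<open>Arbitrary cyclic submodules \<open>uS\<close> of \<open>LS\<close> reduce to graded
  ones: \<open>uS\<close> contains some \<open>v\<close> for which \<open>vS\<close> has the same
  annihilator as \<open>NS\<close> for a nonzero \<open>N\<close> inside \<open>L\<close>, and
  anything killing \<open>uS\<close> kills \<open>vS\<close>.\<close>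

lemma prime_graded_span_iff:
  assumes up: "unique_product_group G" and L: "right_submodule L (base_ring G S D) M"
  shows "prime_right_module S (T\<lparr>carrier := graded_span L\<rparr>) \<longleftrightarrow> L \<noteq> {\<zero>\<^bsub>M\<^esub>} \<and>
    (\<forall>N. right_submodule N (base_ring G S D) M \<and> N \<subseteq> L \<and> N \<noteq> {\<zero>\<^bsub>M\<^esub>} \<longrightarrow> span_ann N \<subseteq> span_ann L)"
proof -
  interpret L: right_submodule L "base_ring G S D" M by fact
  note span_sub = right_submodule_graded_span[OF L]
  interpret span: right_submodule "graded_span L" S T by (rule span_sub)
  interpret span_mod: right_module S "T\<lparr>carrier := graded_span L\<rparr>"
    using span_sub by (rule T.right_module_submodule)
  have "graded_span L \<noteq> {\<zero>\<^bsub>T\<^esub>} \<longleftrightarrow> L \<noteq> {\<zero>\<^bsub>M\<^esub>}"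
  proof
    assume nz: "graded_span L \<noteq> {\<zero>\<^bsub>T\<^esub>}"
    show "L \<noteq> {\<zero>\<^bsub>M\<^esub>}"
    proof
      assume "L = {\<zero>\<^bsub>M\<^esub>}"
      then have "\<one>\<^bsub>S\<^esub> \<in> annihilator S (T\<lparr>carrier := graded_span L\<rparr>)"
        unfolding annihilator_graded_span[OF L] by (simp add: span_ann_def)
      then have "t = \<zero>\<^bsub>T\<^esub>" if "t \<in> graded_span L" for t
        using that span.a_subset T.rsmult_one[of t] by (auto simp: annihilator_def)
      then show False using nz span.zero_closed by blast
    qed
  next
    assume "L \<noteq> {\<zero>\<^bsub>M\<^esub>}"
    then obtain x where "x \<in> L" "x \<noteq> \<zero>\<^bsub>M\<^esub>" using L.zero_closed by blast
    then show "graded_span L \<noteq> {\<zero>\<^bsub>T\<^esub>}"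
      using iota_mem_graded_span[OF L] iota_eq_zeroD L.a_subset by blast
  qed
  moreover have "(\<forall>x\<in>graded_span L - {\<zero>\<^bsub>T\<^esub>}. \<forall>a\<in>carrier S.
        (\<forall>b\<in>carrier S. x \<bullet>\<^bsub>T\<^esub> b \<bullet>\<^bsub>T\<^esub> a = \<zero>\<^bsub>T\<^esub>) \<longrightarrow> a \<in> span_ann L) \<longleftrightarrow>
     (\<forall>N. right_submodule N (base_ring G S D) M \<and> N \<subseteq> L \<and> N \<noteq> {\<zero>\<^bsub>M\<^esub>} \<longrightarrow> span_ann N \<subseteq> span_ann L)"
    (is "?A \<longleftrightarrow> ?B")
  proof
    assume A: ?A
    show ?B
    proof (intro allI impI)
      fix N assume N: "right_submodule N (base_ring G S D) M \<and> N \<subseteq> L \<and> N \<noteq> {\<zero>\<^bsub>M\<^esub>}"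
      then interpret N: right_submodule N "base_ring G S D" M by blast
      obtain x where x: "x \<in> N" "x \<noteq> \<zero>\<^bsub>M\<^esub>" using N N.zero_closed by blast
      then have "\<iota> x \<in> graded_span L - {\<zero>\<^bsub>T\<^esub>}"
        using iota_mem_graded_span[OF L] iota_eq_zeroD N N.a_subset by blast
      then show "span_ann N \<subseteq> span_ann L"
        using A x(1) unfolding span_ann_def by blast
    qed
  next
    assume B: ?B
    show ?A
    proof (intro ballI impI)
      fix u s assume u: "u \<in> graded_span L - {\<zero>\<^bsub>T\<^esub>}" and s: "s \<in> carrier S"
        and kill: "\<forall>b\<in>carrier S. u \<bullet>\<^bsub>T\<^esub> b \<bullet>\<^bsub>T\<^esub> s = \<zero>\<^bsub>T\<^esub>"
      let ?U = "(\<lambda>a. u \<bullet>\<^bsub>T\<^esub> a) ` carrier S"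
      have uT: "u \<in> carrier T" using u span.a_subset by blast
      have "u \<in> ?U" using T.rsmult_one[OF uT] by (metis S.one_closed image_eqI)
      then have nz: "?U \<noteq> {\<zero>\<^bsub>T\<^esub>}" using u by blast
      obtain N v g where N: "right_submodule N (base_ring G S D) M" "N \<noteq> {\<zero>\<^bsub>M\<^esub>}"
        and v: "v \<in> ?U" "v \<noteq> \<zero>\<^bsub>T\<^esub>" and g: "g \<in> carrier G"
        and ann: "span_ann N = {s \<in> carrier S. \<forall>a\<in>carrier S. (v \<bullet>\<^bsub>T\<^esub> a) \<bullet>\<^bsub>T\<^esub> s = \<zero>\<^bsub>T\<^esub>}"
        and N_mem: "\<forall>x\<in>N. \<exists>c\<in>D (inv g). \<iota> x = proj g v \<bullet>\<^bsub>T\<^esub> c"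
        by (rule submodule_contains_graded_copy[OF up T.right_submodule_cyclic[OF uT] nz], rule that)
      interpret N: right_submodule N "base_ring G S D" M by fact
      obtain b where b: "b \<in> carrier S" "v = u \<bullet>\<^bsub>T\<^esub> b" using v(1) by blast
      have "v \<in> graded_span L" using u b span.rsmult_mem by blast
      \<comment> \<open>Every element of \<open>N\<close> has the form \<open>v_g c\<close> with
        \<open>c\<close> of degree \<open>g^-1\<close>, and these products lie in the image of
        \<open>L\<close> because \<open>v\<close> lies in its graded span.\<close>
      have "N \<subseteq> L"
      proof
        fix x assume x: "x \<in> N"
        then obtain c where "c \<in> D (inv g)" "\<iota> x = proj g v \<bullet>\<^bsub>T\<^esub> c" using N_mem by blast
        then have "\<iota> x \<in> \<iota> ` L" using graded_spanD[OF \<open>v \<in> graded_span L\<close> g] by metis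
        then show "x \<in> L" using iota_inj x N.a_subset L.a_subset by blast
      qed
      then have "span_ann N \<subseteq> span_ann L" using B N by blast
      moreover have "v \<bullet>\<^bsub>T\<^esub> a \<bullet>\<^bsub>T\<^esub> s = \<zero>\<^bsub>T\<^esub>" if a: "a \<in> carrier S" for a
      proof -
        have "v \<bullet>\<^bsub>T\<^esub> a = u \<bullet>\<^bsub>T\<^esub> (b \<otimes>\<^bsub>S\<^esub> a)"
          unfolding b(2) using uT b(1) a by (rule T.rsmult_assoc[symmetric])
        then show ?thesis using kill b(1) a by simp
      qed
      then have "s \<in> span_ann N" unfolding ann using s by blast
      ultimately show "s \<in> span_ann L" by blast
    qed
  qed
  ultimately show ?thesis
    using span_mod.prime_right_module_iff by (simp add: annihilator_graded_span[OF L])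
qed

text \<open>A prime \<open>U\<close> has the annihilator of each of its nonzero cyclic submodules,
  in particular of \<open>uS\<close>, which is \<open>span_ann N\<close>. Primeness of
  \<open>NS\<close> is inherited from \<open>U\<close> through the copy \<open>uS\<close>.\<close>

lemma Ass_eq_span_ann:
  assumes up: "unique_product_group G"
  shows "Ass S T = {span_ann L | L. right_submodule L (base_ring G S D) M \<and>
    prime_right_module S (T\<lparr>carrier := graded_span L\<rparr>)}"
proof (intro equalityI subsetI)
  fix P assume "P \<in> {span_ann L | L. right_submodule L (base_ring G S D) M \<and>
    prime_right_module S (T\<lparr>carrier := graded_span L\<rparr>)}"
  then obtain L where L: "P = span_ann L" "right_submodule L (base_ring G S D) M"
    "prime_right_module S (T\<lparr>carrier := graded_span L\<rparr>)" by blast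
  then show "P \<in> Ass S T"
    using right_submodule_graded_span annihilator_graded_span unfolding Ass_def by blast
next
  fix P assume "P \<in> Ass S T"
  then obtain U where P: "P = annihilator S (T\<lparr>carrier := U\<rparr>)"
    and U: "right_submodule U S T" and prime: "prime_right_module S (T\<lparr>carrier := U\<rparr>)"
    unfolding Ass_def by blast
  interpret U: right_submodule U S T by fact
  interpret U_mod: right_module S "T\<lparr>carrier := U\<rparr>"
    using U by (rule T.right_module_submodule)
  have U_nz: "U \<noteq> {\<zero>\<^bsub>T\<^esub>}"
    and U_prime: "\<And>u s. \<lbrakk>u \<in> U; u \<noteq> \<zero>\<^bsub>T\<^esub>; s \<in> carrier S;
       \<forall>a\<in>carrier S. u \<bullet>\<^bsub>T\<^esub> a \<bullet>\<^bsub>T\<^esub> s = \<zero>\<^bsub>T\<^esub>\<rbrakk> \<Longrightarrow> s \<in> P"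
    using prime unfolding U_mod.prime_right_module_iff P by auto
  obtain N u g where N: "right_submodule N (base_ring G S D) M" "N \<noteq> {\<zero>\<^bsub>M\<^esub>}"
    and u: "u \<in> U" "u \<noteq> \<zero>\<^bsub>T\<^esub>"
    and ann: "span_ann N = {s \<in> carrier S. \<forall>a\<in>carrier S. (u \<bullet>\<^bsub>T\<^esub> a) \<bullet>\<^bsub>T\<^esub> s = \<zero>\<^bsub>T\<^esub>}"
    and copy: "\<forall>x\<in>N - {\<zero>\<^bsub>M\<^esub>}. \<exists>b\<in>carrier S. u \<bullet>\<^bsub>T\<^esub> b \<noteq> \<zero>\<^bsub>T\<^esub> \<and>
       (\<forall>s\<in>carrier S. \<forall>a\<in>carrier S.
          (u \<bullet>\<^bsub>T\<^esub> b) \<bullet>\<^bsub>T\<^esub> a \<bullet>\<^bsub>T\<^esub> s = \<zero>\<^bsub>T\<^esub> \<longleftrightarrow> (\<iota> x \<bullet>\<^bsub>T\<^esub> a) \<bullet>\<^bsub>T\<^esub> s = \<zero>\<^bsub>T\<^esub>)"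
    by (rule submodule_contains_graded_copy[OF up U U_nz], rule that)
  have "P \<subseteq> span_ann N"
    unfolding ann P using u(1) U.rsmult_mem by (auto simp: annihilator_def)
  moreover have "span_ann N \<subseteq> P"
    unfolding ann using U_prime[OF u] by blast
  ultimately have eq: "P = span_ann N" by blast
  \<comment> \<open>A nonzero \<open>x\<close> in \<open>N'\<close> corresponds to a nonzero
    \<open>ub\<close> in \<open>U\<close>. A scalar killing \<open>N'S\<close> kills
    \<open>ubS\<close>, and hence all of \<open>U\<close> by primeness.\<close>
  have "span_ann N' \<subseteq> span_ann N"
    if N': "right_submodule N' (base_ring G S D) M" "N' \<subseteq> N" "N' \<noteq> {\<zero>\<^bsub>M\<^esub>}" for N'
  proof
    fix s assume s: "s \<in> span_ann N'"
    interpret N': right_submodule N' "base_ring G S D" M by fact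
    obtain x where x: "x \<in> N'" "x \<noteq> \<zero>\<^bsub>M\<^esub>" using N' N'.zero_closed by blast
    then obtain b where b: "b \<in> carrier S" "u \<bullet>\<^bsub>T\<^esub> b \<noteq> \<zero>\<^bsub>T\<^esub>"
      and iff: "\<And>s a. \<lbrakk>s \<in> carrier S; a \<in> carrier S\<rbrakk> \<Longrightarrow>
          (u \<bullet>\<^bsub>T\<^esub> b) \<bullet>\<^bsub>T\<^esub> a \<bullet>\<^bsub>T\<^esub> s = \<zero>\<^bsub>T\<^esub> \<longleftrightarrow> (\<iota> x \<bullet>\<^bsub>T\<^esub> a) \<bullet>\<^bsub>T\<^esub> s = \<zero>\<^bsub>T\<^esub>"
      using bspec[OF copy, of x] N' by blast
    have "\<forall>a\<in>carrier S. (u \<bullet>\<^bsub>T\<^esub> b) \<bullet>\<^bsub>T\<^esub> a \<bullet>\<^bsub>T\<^esub> s = \<zero>\<^bsub>T\<^esub>"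
      using iff s x(1) by (simp add: span_ann_def)
    then show "s \<in> span_ann N"
      using U_prime[OF U.rsmult_mem[OF u(1) b(1)] b(2)] s eq by (simp add: span_ann_def)
  qed
  then have "prime_right_module S (T\<lparr>carrier := graded_span N\<rparr>)"
    using prime_graded_span_iff[OF up N(1)] N(2) by blast
  then show "P \<in> {span_ann L | L. right_submodule L (base_ring G S D) M \<and>
    prime_right_module S (T\<lparr>carrier := graded_span L\<rparr>)}"
    using eq N(1) by blast
qed

end

section \<open>The tensor product module\<close>

locale tensor_product = S?: ring S + M?: right_module R M
  for R and S (structure) and M (structure) +
  assumes subring_subset: "carrier R \<subseteq> carrier S"
begin

abbreviation "F \<equiv> tensor_free M S"
abbreviation "K \<equiv> tensor_kernel R M S"
abbreviation "T \<equiv> tensor R M S"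

definition tensor_class where "tensor_class c = K #>\<^bsub>F\<^esub> c"

definition pure_tensor (infixl \<open>\<odot>\<close> 70) where "x \<odot> s = tensor_class (frag_of (x, s))"

section \<open>The additive group of the tensor product and its universal property\<close>

lemma one_F [simp]: "one F = 0" and mult_F [simp]: "mult F = (+)"
  by (simp_all add: tensor_free_def free_Abelian_group_def)

text \<open>The rewrites replace the group operations by those of finitely supported functions, so
  that ordinary arithmetic applies to formal sums.\<close>

sublocale F: comm_group F
  rewrites "one F = 0" and "mult F = (+)"
  unfolding one_F mult_F by (simp_all add: tensor_free_def abelian_free_Abelian_group)

lemma carrier_F: "c \<in> carrier F \<longleftrightarrow> Poly_Mapping.keys c \<subseteq> carrier M \<times> carrier S"
  by (simp add: tensor_free_def)

lemma inv_F [simp]: "c \<in> carrier F \<Longrightarrow> inv\<^bsub>F\<^esub> c = - c"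
  by (simp add: tensor_free_def)

lemma F_closed [simp]:
  "0 \<in> carrier F" "c \<in> carrier F \<Longrightarrow> - c \<in> carrier F"
  "\<lbrakk>c \<in> carrier F; d \<in> carrier F\<rbrakk> \<Longrightarrow> c + d \<in> carrier F"
  "\<lbrakk>c \<in> carrier F; d \<in> carrier F\<rbrakk> \<Longrightarrow> c - d \<in> carrier F"
  "frag_of (x, s) \<in> carrier F \<longleftrightarrow> x \<in> carrier M \<and> s \<in> carrier S"
  using F.one_closed F.m_closed F.inv_closed[of c] F.m_closed[of c "- d"] F.inv_closed[of d]
  by (auto simp: carrier_F)

lemma relations_closed: "tensor_relations R M S \<subseteq> carrier F"
  using subring_subset rsmult_closed by (auto simp: tensor_relations_def)

lemma K_subgroup: "subgroup K F"
  unfolding tensor_kernel_def by (rule F.generate_is_subgroup[OF relations_closed])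

lemma K_normal: "K \<lhd> F"
  using K_subgroup by (simp add: F.normal_iff_subgroup)

lemma tensor_class_eqI:
  assumes "c \<in> carrier F" "d \<in> carrier F" "c - d \<in> K"
  shows "tensor_class c = tensor_class d"
proof -
  have "c \<in> K #>\<^bsub>F\<^esub> d"
    using subgroup.rcos_module_rev[OF K_subgroup F.is_group assms(2,1)] assms by simp
  then show ?thesis
    unfolding tensor_class_def using F.repr_independence[OF _ assms(2) K_subgroup] by simp
qed

lemma carrier_tensor: "carrier T = tensor_class ` carrier F"
  by (simp add: tensor_def Let_def carrier_FactGroup tensor_class_def)

lemma zero_tensor: "\<zero>\<^bsub>T\<^esub> = tensor_class 0"
  using F.coset_mult_one[OF subgroup.subset[OF K_subgroup]]
  by (simp add: tensor_def Let_def tensor_class_def)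

lemma add_tensor:
  "\<lbrakk>c \<in> carrier F; d \<in> carrier F\<rbrakk> \<Longrightarrow> tensor_class c \<oplus>\<^bsub>T\<^esub> tensor_class d = tensor_class (c + d)"
  using normal.rcos_sum[OF K_normal] by (simp add: tensor_def Let_def tensor_class_def)

lemma tensor_class_closed [simp]: "c \<in> carrier F \<Longrightarrow> tensor_class c \<in> carrier T"
  by (simp add: carrier_tensor)

sublocale T: abelian_group T
proof (rule abelian_groupI)
  fix X assume "X \<in> carrier T"
  then obtain c where "c \<in> carrier F" "X = tensor_class c" by (auto simp: carrier_tensor)
  then show "\<exists>Y\<in>carrier T. Y \<oplus>\<^bsub>T\<^esub> X = \<zero>\<^bsub>T\<^esub>"
    by (intro bexI[of _ "tensor_class (- c)"]) (simp_all add: add_tensor zero_tensor)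
qed (auto simp: carrier_tensor zero_tensor add_tensor add_ac intro!: imageI)

lemma pure_tensor_closed [simp]:
  "\<lbrakk>x \<in> carrier M; s \<in> carrier S\<rbrakk> \<Longrightarrow> x \<odot> s \<in> carrier T"
  by (simp add: pure_tensor_def)

lemma relation_in_K: "c \<in> tensor_relations R M S \<Longrightarrow> c \<in> K"
  unfolding tensor_kernel_def by (rule generate.incl)

lemma pure_tensor_l_add:
  assumes "x \<in> carrier M" "y \<in> carrier M" "s \<in> carrier S"
  shows "(x \<oplus>\<^bsub>M\<^esub> y) \<odot> s = x \<odot> s \<oplus>\<^bsub>T\<^esub> y \<odot> s"
proof -
  have "frag_of (x \<oplus>\<^bsub>M\<^esub> y, s) - (frag_of (x, s) + frag_of (y, s)) \<in> tensor_relations R M S"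
    using assms unfolding tensor_relations_def diff_diff_eq[symmetric] by blast
  from tensor_class_eqI[OF _ _ relation_in_K[OF this]] show ?thesis
    using assms by (simp add: pure_tensor_def add_tensor)
qed

lemma pure_tensor_r_add:
  assumes "x \<in> carrier M" "s \<in> carrier S" "t \<in> carrier S"
  shows "x \<odot> (s \<oplus>\<^bsub>S\<^esub> t) = x \<odot> s \<oplus>\<^bsub>T\<^esub> x \<odot> t"
proof -
  have "frag_of (x, s \<oplus>\<^bsub>S\<^esub> t) - (frag_of (x, s) + frag_of (x, t)) \<in> tensor_relations R M S"
    using assms unfolding tensor_relations_def diff_diff_eq[symmetric] by blast
  from tensor_class_eqI[OF _ _ relation_in_K[OF this]] show ?thesis
    using assms by (simp add: pure_tensor_def add_tensor)
qed

lemma pure_tensor_balanced: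
  assumes "x \<in> carrier M" "r \<in> carrier R" "s \<in> carrier S"
  shows "(x \<bullet>\<^bsub>M\<^esub> r) \<odot> s = x \<odot> (r \<otimes>\<^bsub>S\<^esub> s)"
proof -
  have "frag_of (x \<bullet>\<^bsub>M\<^esub> r, s) - frag_of (x, r \<otimes>\<^bsub>S\<^esub> s) \<in> tensor_relations R M S"
    using assms unfolding tensor_relations_def by blast
  moreover have "r \<in> carrier S" using assms subring_subset by blast
  ultimately show ?thesis
    using assms rsmult_closed tensor_class_eqI[OF _ _ relation_in_K] by (simp add: pure_tensor_def)
qed

lemma pure_tensor_zero [simp]:
  "s \<in> carrier S \<Longrightarrow> \<zero>\<^bsub>M\<^esub> \<odot> s = \<zero>\<^bsub>T\<^esub>" "x \<in> carrier M \<Longrightarrow> x \<odot> \<zero>\<^bsub>S\<^esub> = \<zero>\<^bsub>T\<^esub>"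
  using pure_tensor_l_add[of "\<zero>\<^bsub>M\<^esub>" "\<zero>\<^bsub>M\<^esub>" s] pure_tensor_r_add[of x "\<zero>\<^bsub>S\<^esub>" "\<zero>\<^bsub>S\<^esub>"]
  by (simp_all add: T.add.l_cancel_one)

lemma pure_tensor_l_minus:
  assumes "x \<in> carrier M" "s \<in> carrier S"
  shows "(\<ominus>\<^bsub>M\<^esub> x) \<odot> s = \<ominus>\<^bsub>T\<^esub> (x \<odot> s)"
  using assms pure_tensor_l_add[of "\<ominus>\<^bsub>M\<^esub> x" x s] by (simp add: M.l_neg T.minus_equality)

lemma tensor_class_minus:
  assumes "c \<in> carrier F"
  shows "tensor_class (- c) = \<ominus>\<^bsub>T\<^esub> tensor_class c"
  using assms add_tensor[of "- c" c] by (simp add: zero_tensor T.minus_equality)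

lemma tensor_induct [consumes 1, case_names zero pure add]:
  assumes X: "X \<in> carrier T" and zero: "P \<zero>\<^bsub>T\<^esub>"
    and pure: "\<And>x s. \<lbrakk>x \<in> carrier M; s \<in> carrier S\<rbrakk> \<Longrightarrow> P (x \<odot> s)"
    and add: "\<And>X Y. \<lbrakk>X \<in> carrier T; Y \<in> carrier T; P X; P Y\<rbrakk> \<Longrightarrow> P (X \<oplus>\<^bsub>T\<^esub> Y)"
  shows "P X"
proof -
  obtain c where c: "c \<in> carrier F" "X = tensor_class c" using X by (auto simp: carrier_tensor)
  have "Poly_Mapping.keys c \<subseteq> carrier M \<times> carrier S" using c(1) by (simp add: carrier_F)
  \<comment> \<open>The induction on formal sums proceeds by differences, hence the claim for both
    \<open>c\<close> and \<open>-c\<close>; the negative of a generator is again pure, as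
    \<open>-(x \<odot> s) = (-x) \<odot> s\<close>.\<close>
  then have "P (tensor_class c) \<and> P (tensor_class (- c))"
  proof (rule free_Abelian_group_induct)
    show "P (tensor_class 0) \<and> P (tensor_class (- 0))"
      using zero by (simp add: zero_tensor)
  next
    fix c d :: "_ \<Rightarrow>\<^sub>0 int"
    assume "Poly_Mapping.keys c \<subseteq> carrier M \<times> carrier S" "Poly_Mapping.keys d \<subseteq> carrier M \<times> carrier S"
    then have cd: "c \<in> carrier F" "d \<in> carrier F" by (simp_all add: carrier_F)
    assume "P (tensor_class c) \<and> P (tensor_class (- c))" "P (tensor_class d) \<and> P (tensor_class (- d))"
    then have "P (tensor_class c \<oplus>\<^bsub>T\<^esub> tensor_class (- d))" "P (tensor_class (- c) \<oplus>\<^bsub>T\<^esub> tensor_class d)"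
      using cd by (auto intro: add)
    then show "P (tensor_class (c - d)) \<and> P (tensor_class (- (c - d)))"
      using cd by (simp add: add_tensor)
  next
    fix a assume "a \<in> carrier M \<times> carrier S"
    then obtain x s where a: "a = (x, s)" "x \<in> carrier M" "s \<in> carrier S" by blast
    then have "tensor_class (- frag_of a) = \<ominus>\<^bsub>T\<^esub> (x \<odot> s)"
      by (simp add: tensor_class_minus pure_tensor_def)
    also have "\<dots> = (\<ominus>\<^bsub>M\<^esub> x) \<odot> s"
      using a by (simp add: pure_tensor_l_minus)
    finally show "P (tensor_class (frag_of a)) \<and> P (tensor_class (- frag_of a))"
      using pure[of x s] pure[of "\<ominus>\<^bsub>M\<^esub> x" s] a by (simp add: pure_tensor_def)
  qed
  then show ?thesis using c by simp
qed

text \<open>The universal property for balanced biadditive maps. Its purpose is to show pure tensors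
  to be nonzero, so the values on pure tensors and at zero are what it returns.\<close>

lemma tensor_lift:
  assumes B: "abelian_group B"
    and closed: "\<And>x s. \<lbrakk>x \<in> carrier M; s \<in> carrier S\<rbrakk> \<Longrightarrow> f x s \<in> carrier B"
    and l_add: "\<And>x y s. \<lbrakk>x \<in> carrier M; y \<in> carrier M; s \<in> carrier S\<rbrakk> \<Longrightarrow>
      f (x \<oplus>\<^bsub>M\<^esub> y) s = f x s \<oplus>\<^bsub>B\<^esub> f y s"
    and r_add: "\<And>x s t. \<lbrakk>x \<in> carrier M; s \<in> carrier S; t \<in> carrier S\<rbrakk> \<Longrightarrow>
      f x (s \<oplus>\<^bsub>S\<^esub> t) = f x s \<oplus>\<^bsub>B\<^esub> f x t"
    and balanced: "\<And>x r s. \<lbrakk>x \<in> carrier M; r \<in> carrier R; s \<in> carrier S\<rbrakk> \<Longrightarrow>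
      f (x \<bullet>\<^bsub>M\<^esub> r) s = f x (r \<otimes>\<^bsub>S\<^esub> s)"
  obtains h where "\<And>x s. \<lbrakk>x \<in> carrier M; s \<in> carrier S\<rbrakk> \<Longrightarrow> h (x \<odot> s) = f x s"
    and "h \<zero>\<^bsub>T\<^esub> = \<zero>\<^bsub>B\<^esub>"
proof -
  interpret B: abelian_group B by fact
  have "(\<lambda>(x, s). f x s) ` (carrier M \<times> carrier S) \<subseteq> carrier (add_monoid B)"
    using closed by auto
  then obtain h where h: "h \<in> hom F (add_monoid B)"
    and h_of: "\<And>x. x \<in> carrier M \<times> carrier S \<Longrightarrow> h (frag_of x) = (\<lambda>(x, s). f x s) x"
    using comm_group.free_Abelian_group_universal[OF B.a_comm_group]
    unfolding tensor_free_def by blast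
  interpret h: group_hom F "add_monoid B" h
    using h by (simp add: group_hom_def group_hom_axioms_def F.is_group B.a_group)
  have h_diff: "h (c - d) = h c \<ominus>\<^bsub>B\<^esub> h d" if "c \<in> carrier F" "d \<in> carrier F" for c d
    using h.hom_mult[of c "- d"] h.hom_inv[of d] that by (simp add: B.minus_eq a_inv_def)
  have cancel: "a \<oplus>\<^bsub>B\<^esub> b \<ominus>\<^bsub>B\<^esub> a \<ominus>\<^bsub>B\<^esub> b = \<zero>\<^bsub>B\<^esub>"
    if ab: "a \<in> carrier B" "b \<in> carrier B" for a b
  proof -
    have "a \<oplus>\<^bsub>B\<^esub> b \<ominus>\<^bsub>B\<^esub> a \<ominus>\<^bsub>B\<^esub> b = (a \<oplus>\<^bsub>B\<^esub> b) \<oplus>\<^bsub>B\<^esub> (\<ominus>\<^bsub>B\<^esub> a \<oplus>\<^bsub>B\<^esub> \<ominus>\<^bsub>B\<^esub> b)"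
      using ab by (simp add: B.minus_eq B.a_assoc)
    also have "\<dots> = \<zero>\<^bsub>B\<^esub>"
      using ab by (metis B.minus_add B.r_neg B.a_closed)
    finally show ?thesis .
  qed
  have "h c = \<zero>\<^bsub>B\<^esub>" if "c \<in> tensor_relations R M S" for c
    using that unfolding tensor_relations_def
  proof (elim UnE CollectE exE conjE)
    fix x y s assume c: "c = frag_of (x \<oplus>\<^bsub>M\<^esub> y, s) - frag_of (x, s) - frag_of (y, s)"
      and xys: "x \<in> carrier M" "y \<in> carrier M" "s \<in> carrier S"
    have "h c = f (x \<oplus>\<^bsub>M\<^esub> y) s \<ominus>\<^bsub>B\<^esub> f x s \<ominus>\<^bsub>B\<^esub> f y s"
      unfolding c using xys by (simp add: h_diff h_of)
    then show ?thesis
      using xys closed by (simp add: l_add cancel)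
  next
    fix x s t assume c: "c = frag_of (x, s \<oplus>\<^bsub>S\<^esub> t) - frag_of (x, s) - frag_of (x, t)"
      and xst: "x \<in> carrier M" "s \<in> carrier S" "t \<in> carrier S"
    have "h c = f x (s \<oplus>\<^bsub>S\<^esub> t) \<ominus>\<^bsub>B\<^esub> f x s \<ominus>\<^bsub>B\<^esub> f x t"
      unfolding c using xst by (simp add: h_diff h_of)
    then show ?thesis
      using xst closed by (simp add: r_add cancel)
  next
    fix x r s assume c: "c = frag_of (x \<bullet>\<^bsub>M\<^esub> r, s) - frag_of (x, r \<otimes>\<^bsub>S\<^esub> s)"
      and xrs: "x \<in> carrier M" "r \<in> carrier R" "s \<in> carrier S"
    have "h c = f (x \<bullet>\<^bsub>M\<^esub> r) s \<ominus>\<^bsub>B\<^esub> f x (r \<otimes>\<^bsub>S\<^esub> s)"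
      unfolding c using xrs subring_subset rsmult_closed by (subst h_diff) (auto simp: h_of)
    moreover have "r \<otimes>\<^bsub>S\<^esub> s \<in> carrier S" using xrs subring_subset by auto
    ultimately show ?thesis
      using xrs closed by (simp add: balanced B.minus_eq B.r_neg)
  qed
  then have "tensor_relations R M S \<subseteq> kernel F (add_monoid B) h"
    using relations_closed by (auto simp: kernel_def)
  then have "K \<subseteq> kernel F (add_monoid B) h"
    unfolding tensor_kernel_def by (intro F.generate_subgroup_incl h.subgroup_kernel)
  then obtain h' where h': "h' \<in> hom (F Mod K) (add_monoid B)"
    "\<And>c. c \<in> carrier F \<Longrightarrow> h' (tensor_class c) = h c"
    unfolding tensor_class_def using h.FactGroup_universal_kernel[OF K_normal] by blast
  show thesis
  proof (rule that)
    show "h' (x \<odot> s) = f x s" if "x \<in> carrier M" "s \<in> carrier S" for x s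
      using that h'(2) by (simp add: pure_tensor_def h_of)
    show "h' \<zero>\<^bsub>T\<^esub> = \<zero>\<^bsub>B\<^esub>"
      using h'(2)[of 0] h.hom_one by (simp add: zero_tensor)
  qed
qed

text \<open>This is the endomorphism \<open>id \<otimes> f\<close>. The union over representatives
  mirrors the action in \<open>tensor\<close>, so that scalar multiplication and the projections of
  the grading are both instances.\<close>

definition tensor_map where
  "tensor_map f X = (\<Union>c\<in>X. tensor_class (frag_extend (\<lambda>(x, s). frag_of (x, f s)) c))"

lemma rsmult_tensor: "X \<bullet>\<^bsub>T\<^esub> t = tensor_map (\<lambda>s. s \<otimes>\<^bsub>S\<^esub> t) X"
  by (simp add: tensor_def Let_def tensor_map_def tensor_class_def tensor_act_def)

definition left_linear where
  "left_linear f \<longleftrightarrow> f \<in> carrier S \<rightarrow> carrier S \<and>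
    (\<forall>s\<in>carrier S. \<forall>t\<in>carrier S. f (s \<oplus>\<^bsub>S\<^esub> t) = f s \<oplus>\<^bsub>S\<^esub> f t) \<and>
    (\<forall>r\<in>carrier R. \<forall>s\<in>carrier S. f (r \<otimes>\<^bsub>S\<^esub> s) = r \<otimes>\<^bsub>S\<^esub> f s)"

context
  fixes f
  assumes f: "left_linear f"
begin

private lemma f_closed [simp]: "s \<in> carrier S \<Longrightarrow> f s \<in> carrier S"
  and f_add: "\<lbrakk>s \<in> carrier S; t \<in> carrier S\<rbrakk> \<Longrightarrow> f (s \<oplus>\<^bsub>S\<^esub> t) = f s \<oplus>\<^bsub>S\<^esub> f t"
  and f_linear: "\<lbrakk>r \<in> carrier R; s \<in> carrier S\<rbrakk> \<Longrightarrow> f (r \<otimes>\<^bsub>S\<^esub> s) = r \<otimes>\<^bsub>S\<^esub> f s"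
  using f by (auto simp: left_linear_def)

private abbreviation "act \<equiv> frag_extend (\<lambda>(x, s). frag_of (x, f s))"

private lemma extend_closed [simp]: "c \<in> carrier F \<Longrightarrow> act c \<in> carrier F"
  unfolding carrier_F using keys_frag_extend[of "\<lambda>(x, s). frag_of (x, f s)" c] by fastforce

text \<open>Well-definedness of \<open>id \<otimes> f\<close>: each relation goes to one of the same
  family, by additivity of \<open>f\<close> for sums in the second argument and by left linearity
  for scalars moved across.\<close>

private lemma extend_K:
  assumes "c \<in> K"
  shows "act c \<in> K"
proof -
  have rel: "act c \<in> tensor_relations R M S" if "c \<in> tensor_relations R M S" for c
    using that[unfolded tensor_relations_def]
  proof (elim UnE CollectE exE conjE)
    fix x y s assume "c = frag_of (x \<oplus>\<^bsub>M\<^esub> y, s) - frag_of (x, s) - frag_of (y, s)"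
      and *: "x \<in> carrier M" "y \<in> carrier M" "s \<in> carrier S"
    then have "act c = frag_of (x \<oplus>\<^bsub>M\<^esub> y, f s) - frag_of (x, f s) - frag_of (y, f s)"
      by (simp add: frag_extend_diff)
    with * f_closed[OF *(3)] show ?thesis unfolding tensor_relations_def by blast
  next
    fix x s t assume "c = frag_of (x, s \<oplus>\<^bsub>S\<^esub> t) - frag_of (x, s) - frag_of (x, t)"
      and *: "x \<in> carrier M" "s \<in> carrier S" "t \<in> carrier S"
    then have "act c = frag_of (x, f s \<oplus>\<^bsub>S\<^esub> f t) - frag_of (x, f s) - frag_of (x, f t)"
      by (simp add: frag_extend_diff f_add)
    with * f_closed[OF *(2)] f_closed[OF *(3)] show ?thesis
      unfolding tensor_relations_def by blast
  next
    fix x r s assume "c = frag_of (x \<bullet>\<^bsub>M\<^esub> r, s) - frag_of (x, r \<otimes>\<^bsub>S\<^esub> s)"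
      and *: "x \<in> carrier M" "r \<in> carrier R" "s \<in> carrier S"
    then have "act c = frag_of (x \<bullet>\<^bsub>M\<^esub> r, f s) - frag_of (x, r \<otimes>\<^bsub>S\<^esub> f s)"
      by (simp add: frag_extend_diff f_linear)
    with * f_closed[OF *(3)] show ?thesis unfolding tensor_relations_def by blast
  qed
  show ?thesis
    using assms unfolding tensor_kernel_def
  proof induction
    case (incl c)
    then show ?case by (intro generate.incl rel)
  next
    case (inv c)
    then have "c \<in> carrier F" "act c \<in> carrier F" using relations_closed by auto
    then show ?case
      using generate.inv[OF rel[OF inv], of F] by (simp add: frag_extend_minus)
  next
    case (eng c d)
    then show ?case
      using generate.eng[of _ F] by (simp add: frag_extend_add)
  qed (use generate.one[of F] in simp)
qed

private lemma tensor_map_class: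
  assumes c: "c \<in> carrier F"
  shows "tensor_map f (tensor_class c) = tensor_class (act c)"
proof -
  have "tensor_class (act d) = tensor_class (act c)" if d: "d \<in> tensor_class c" for d
  proof -
    obtain k where k: "k \<in> K" "d = k + c"
      using d by (auto simp: tensor_class_def r_coset_def)
    then have "k \<in> carrier F" using subgroup.subset[OF K_subgroup] by blast
    then show ?thesis
      using k c extend_K[OF k(1)] by (intro tensor_class_eqI) (auto simp: frag_extend_add)
  qed
  moreover have "c \<in> tensor_class c"
    unfolding tensor_class_def by (rule F.rcos_self[OF c K_subgroup])
  ultimately show ?thesis unfolding tensor_map_def by blast
qed

lemma tensor_map_closed: "X \<in> carrier T \<Longrightarrow> tensor_map f X \<in> carrier T"
  by (auto simp: carrier_tensor tensor_map_class)

lemma tensor_map_pure: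
  "\<lbrakk>x \<in> carrier M; s \<in> carrier S\<rbrakk> \<Longrightarrow> tensor_map f (x \<odot> s) = x \<odot> f s"
  by (simp add: pure_tensor_def tensor_map_class)

lemma tensor_map_zero: "tensor_map f \<zero>\<^bsub>T\<^esub> = \<zero>\<^bsub>T\<^esub>"
  by (simp add: zero_tensor tensor_map_class)

lemma tensor_map_add:
  assumes "X \<in> carrier T" "Y \<in> carrier T"
  shows "tensor_map f (X \<oplus>\<^bsub>T\<^esub> Y) = tensor_map f X \<oplus>\<^bsub>T\<^esub> tensor_map f Y"
proof -
  obtain c d where "c \<in> carrier F" "X = tensor_class c" "d \<in> carrier F" "Y = tensor_class d"
    using assms by (auto simp: carrier_tensor)
  then show ?thesis
    by (simp add: add_tensor tensor_map_class frag_extend_add)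
qed

end

end

text \<open>
  Grading of \<open>M \<otimes>\<^sub>R S\<close>: the projections are induced by those of \<open>S\<close>, and the
  identity component is recognised by the retraction \<open>x \<otimes> s \<mapsto> x s\<^sub>e\<close>.
\<close>

locale graded_tensor = strongly_graded_ring G S D + M?: right_module "base_ring G S D" M
  for G (structure) and S (structure) and D and M (structure)

sublocale graded_tensor \<subseteq> tensor_product "base_ring G S D" S M
  by unfold_locales (simp add: subset_iff component_set_closed(1)[OF G.one_closed])

context graded_tensor
begin

abbreviation pure_tensor_graded (infixl \<open>\<odot>\<close> 70) where "x \<odot> s \<equiv> pure_tensor x s"

section \<open>Module structure and grading of the tensor product\<close>

lemma left_linear_component: "g \<in> carrier G \<Longrightarrow> left_linear (component g)"
  unfolding left_linear_def using component_mult_left[of g \<one>] component_add[of g] by force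

lemma left_linear_mult: "t \<in> carrier S \<Longrightarrow> left_linear (\<lambda>s. s \<otimes>\<^bsub>S\<^esub> t)"
  unfolding left_linear_def base_ring_simps
proof (intro conjI ballI)
  fix r s assume "t \<in> carrier S" "r \<in> D \<one>" "s \<in> carrier S"
  then show "r \<otimes>\<^bsub>S\<^esub> s \<otimes>\<^bsub>S\<^esub> t = r \<otimes>\<^bsub>S\<^esub> (s \<otimes>\<^bsub>S\<^esub> t)"
    using component_set_closed(1)[OF G.one_closed, of r] by (simp add: S.m_assoc)
qed (simp_all add: S.l_distr)

lemmas proj_tensor_closed = tensor_map_closed[OF left_linear_component]
  and proj_tensor_pure = tensor_map_pure[OF left_linear_component]
  and proj_tensor_zero = tensor_map_zero[OF left_linear_component]
  and proj_tensor_add = tensor_map_add[OF left_linear_component]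

lemmas rsmult_tensor_closed = tensor_map_closed[OF left_linear_mult, folded rsmult_tensor]
  and rsmult_tensor_pure = tensor_map_pure[OF left_linear_mult, folded rsmult_tensor]
  and rsmult_tensor_zero = tensor_map_zero[OF left_linear_mult, folded rsmult_tensor]
  and rsmult_tensor_add = tensor_map_add[OF left_linear_mult, folded rsmult_tensor]

lemma tensor_right_module: "right_module S T"
proof (intro right_module.intro right_module_axioms.intro)
  show "ring S" "abelian_group T" by unfold_locales
next
  fix X a b assume X: "X \<in> carrier T" and ab: "a \<in> carrier S" "b \<in> carrier S"
  show "X \<bullet>\<^bsub>T\<^esub> (a \<oplus>\<^bsub>S\<^esub> b) = X \<bullet>\<^bsub>T\<^esub> a \<oplus>\<^bsub>T\<^esub> X \<bullet>\<^bsub>T\<^esub> b"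
    using X
  proof (induction rule: tensor_induct)
    case (add X Y)
    then show ?case using ab by (simp add: rsmult_tensor_add rsmult_tensor_closed T.a_ac)
  qed (use ab in \<open>simp_all add: rsmult_tensor_zero rsmult_tensor_pure S.r_distr pure_tensor_r_add\<close>)
  show "X \<bullet>\<^bsub>T\<^esub> (a \<otimes>\<^bsub>S\<^esub> b) = X \<bullet>\<^bsub>T\<^esub> a \<bullet>\<^bsub>T\<^esub> b"
    using X
    by (induction rule: tensor_induct) (use ab in \<open>simp_all add: rsmult_tensor_zero
      rsmult_tensor_pure rsmult_tensor_add rsmult_tensor_closed S.m_assoc\<close>)
next
  fix X assume "X \<in> carrier T"
  then show "X \<bullet>\<^bsub>T\<^esub> \<one>\<^bsub>S\<^esub> = X"
    by (induction rule: tensor_induct)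
      (simp_all add: rsmult_tensor_zero rsmult_tensor_pure rsmult_tensor_add rsmult_tensor_closed)
qed (simp_all add: rsmult_tensor_closed rsmult_tensor_add)

text \<open>\<open>I\<close> may exceed the support of \<open>X\<close>: for a sum of two elements
  the union of their index sets works, whereas cancellation can shrink the support.\<close>

lemma tensor_finsum_proj:
  assumes "X \<in> carrier T"
  obtains I where "finite I" "I \<subseteq> carrier G"
    "\<And>g. g \<in> carrier G - I \<Longrightarrow> tensor_map (component g) X = \<zero>\<^bsub>T\<^esub>"
    "X = finsum T (\<lambda>g. tensor_map (component g) X) I"
proof -
  let ?p = "\<lambda>g X. tensor_map (component g) X"
  have "\<exists>I. finite I \<and> I \<subseteq> carrier G \<and> (\<forall>g\<in>carrier G - I. ?p g X = \<zero>\<^bsub>T\<^esub>) \<and>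
      X = finsum T (\<lambda>g. ?p g X) I"
    using assms
  proof (induction rule: tensor_induct)
    case zero
    show ?case by (rule exI[of _ "{}"]) (simp add: proj_tensor_zero)
  next
    case (pure x s)
    let ?I = "{g \<in> carrier G. component g s \<noteq> \<zero>\<^bsub>S\<^esub>}"
    have "(\<lambda>s. x \<odot> s) \<in> hom (add_monoid S) (add_monoid T)"
      using pure by (simp add: hom_def pure_tensor_r_add)
    then have "x \<odot> finsum S (\<lambda>g. component g s) ?I = finsum T (\<lambda>g. x \<odot> component g s) ?I"
      using pure T.abelian_group_axioms by (intro S.finsum_hom) auto
    also have "\<dots> = finsum T (\<lambda>g. ?p g (x \<odot> s)) ?I"
      using pure by (intro T.finsum_cong') (simp_all add: proj_tensor_pure)
    finally have "x \<odot> s = finsum T (\<lambda>g. ?p g (x \<odot> s)) ?I"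
      using component_finsum[OF pure(2)] by (rule trans[OF arg_cong, rotated])
    moreover have "\<forall>g\<in>carrier G - ?I. ?p g (x \<odot> s) = \<zero>\<^bsub>T\<^esub>"
      using pure by (simp add: proj_tensor_pure)
    ultimately show ?case using finite_component[OF pure(2)] by blast
  next
    case (add X Y)
    obtain I where I: "finite I" "I \<subseteq> carrier G" "\<forall>g\<in>carrier G - I. ?p g X = \<zero>\<^bsub>T\<^esub>"
      "X = finsum T (\<lambda>g. ?p g X) I" using add.IH(1) by blast
    obtain J where J: "finite J" "J \<subseteq> carrier G" "\<forall>g\<in>carrier G - J. ?p g Y = \<zero>\<^bsub>T\<^esub>"
      "Y = finsum T (\<lambda>g. ?p g Y) J" using add.IH(2) by blast
    have p: "(\<lambda>g. ?p g Z) \<in> I \<union> J \<rightarrow> carrier T" if "Z \<in> carrier T" for Z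
      using I(2) J(2) proj_tensor_closed that by blast
    have "finsum T (\<lambda>g. ?p g X) I = finsum T (\<lambda>g. ?p g X) (I \<union> J)"
      by (rule T.add.finprod_mono_neutral_cong_left) (use I(1-3) J(1-3) p add.hyps in auto)
    moreover have "finsum T (\<lambda>g. ?p g Y) J = finsum T (\<lambda>g. ?p g Y) (I \<union> J)"
      by (rule T.add.finprod_mono_neutral_cong_left) (use I(1-3) J(1-3) p add.hyps in auto)
    ultimately have "X \<oplus>\<^bsub>T\<^esub> Y = finsum T (\<lambda>g. ?p g X) (I \<union> J) \<oplus>\<^bsub>T\<^esub> finsum T (\<lambda>g. ?p g Y) (I \<union> J)"
      using I(4) J(4) by metis
    also have "\<dots> = finsum T (\<lambda>g. ?p g X \<oplus>\<^bsub>T\<^esub> ?p g Y) (I \<union> J)"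
      by (rule T.finsum_addf[symmetric]) (rule p add.hyps)+
    also have "\<dots> = finsum T (\<lambda>g. ?p g (X \<oplus>\<^bsub>T\<^esub> Y)) (I \<union> J)"
      using I(2) J(2) add.hyps p[OF T.a_closed]
      by (intro T.finsum_cong') (auto simp add: proj_tensor_add subset_iff)
    finally have eq: "X \<oplus>\<^bsub>T\<^esub> Y = finsum T (\<lambda>g. ?p g (X \<oplus>\<^bsub>T\<^esub> Y)) (I \<union> J)" .
    have "\<forall>g\<in>carrier G - (I \<union> J). ?p g (X \<oplus>\<^bsub>T\<^esub> Y) = \<zero>\<^bsub>T\<^esub>"
      using I(3) J(3) add.hyps by (simp add: proj_tensor_add)
    with eq show ?case using I(1,2) J(1,2) by (intro exI[of _ "I \<union> J"] conjI) blast+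
  qed
  then show thesis using that by blast
qed

lemma tensor_graded_right_module:
  "graded_right_module G S D T (\<lambda>g. tensor_map (component g))"
proof (intro graded_right_module.intro graded_right_module_axioms.intro tensor_right_module
    strongly_graded_ring_axioms)
  fix g h X assume g: "g \<in> carrier G" and h: "h \<in> carrier G" and X: "X \<in> carrier T"
  show "tensor_map (component g) (tensor_map (component h) X) =
      (if g = h then tensor_map (component g) X else \<zero>\<^bsub>T\<^esub>)"
    using X
    by (induction rule: tensor_induct) (use g h in \<open>simp_all add: proj_tensor_zero proj_tensor_pure
      proj_tensor_add proj_tensor_closed component_component\<close>)
next
  fix X assume "X \<in> carrier T"
  then obtain I where I: "finite I" "I \<subseteq> carrier G"
    "\<And>g. g \<in> carrier G - I \<Longrightarrow> tensor_map (component g) X = \<zero>\<^bsub>T\<^esub>"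
    using tensor_finsum_proj by metis
  then have "{g \<in> carrier G. tensor_map (component g) X \<noteq> \<zero>\<^bsub>T\<^esub>} \<subseteq> I" by blast
  then show "finite {g \<in> carrier G. tensor_map (component g) X \<noteq> \<zero>\<^bsub>T\<^esub>}"
    using I(1) finite_subset by blast
next
  fix X H assume X: "X \<in> carrier T" and H: "additive_subgroup H T"
    and mem: "\<And>g. g \<in> carrier G \<Longrightarrow> tensor_map (component g) X \<in> H"
  interpret H: additive_subgroup H T by fact
  obtain I where I: "finite I" "I \<subseteq> carrier G"
    "X = finsum T (\<lambda>g. tensor_map (component g) X) I"
    using tensor_finsum_proj[OF X] by metis
  have "finsum T (\<lambda>g. tensor_map (component g) X) I \<in> H"
    using I(1,2)
  proof induction
    case (insert g I)
    moreover have "(\<lambda>g. tensor_map (component g) X) \<in> I \<rightarrow> carrier T"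
      using insert.prems X proj_tensor_closed by blast
    ultimately show ?case
      using mem[of g] proj_tensor_closed[of g X] X by simp
  qed simp
  then show "X \<in> H" using I(3) by metis
next
  fix g h X a assume g: "g \<in> carrier G" and h: "h \<in> carrier G" and X: "X \<in> carrier T" and a: "a \<in> D h"
  have aS: "a \<in> carrier S" using a h component_set_closed(1) by blast
  show "tensor_map (component (g \<otimes> h)) (X \<bullet>\<^bsub>T\<^esub> a) = tensor_map (component g) X \<bullet>\<^bsub>T\<^esub> a"
    using X
    by (induction rule: tensor_induct) (use g h a aS in \<open>simp_all add: proj_tensor_zero
      proj_tensor_pure proj_tensor_add proj_tensor_closed rsmult_tensor_zero rsmult_tensor_pure
      rsmult_tensor_add rsmult_tensor_closed component_mult_right\<close>)
qed (simp_all add: proj_tensor_closed proj_tensor_add)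

lemma tensor_graded_extension:
  "graded_extension G S D T (\<lambda>g. tensor_map (component g)) M (\<lambda>x. x \<odot> \<one>\<^bsub>S\<^esub>)"
proof (intro graded_extension.intro graded_extension_axioms.intro tensor_graded_right_module
    M.right_module_axioms)
  fix x r assume x: "x \<in> carrier M" and r: "r \<in> D \<one>"
  then show "(x \<bullet>\<^bsub>M\<^esub> r) \<odot> \<one>\<^bsub>S\<^esub> = (x \<odot> \<one>\<^bsub>S\<^esub>) \<bullet>\<^bsub>T\<^esub> r"
    using component_set_closed(1)[OF G.one_closed r]
    by (simp add: pure_tensor_balanced rsmult_tensor_pure)
next
  fix x assume x: "x \<in> carrier M" and 0: "x \<odot> \<one>\<^bsub>S\<^esub> = \<zero>\<^bsub>T\<^esub>"
  have act: "y \<bullet>\<^bsub>M\<^esub> component \<one> s \<in> carrier M" if "y \<in> carrier M" "s \<in> carrier S" for y s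
    using that M.rsmult_closed[of y "component \<one> s"] by simp
  \<comment> \<open>Since \<open>1\<close> has degree \<open>e\<close>, this retraction sends
    \<open>x \<odot> 1\<close> to \<open>x\<close>; so \<open>x \<odot> 1 = 0\<close> forces
    \<open>x = 0\<close>.\<close>
  obtain h where h: "\<And>x s. \<lbrakk>x \<in> carrier M; s \<in> carrier S\<rbrakk> \<Longrightarrow> h (x \<odot> s) = x \<bullet>\<^bsub>M\<^esub> component \<one> s"
    and h0: "h \<zero>\<^bsub>T\<^esub> = \<zero>\<^bsub>M\<^esub>"
  proof (rule tensor_lift[of M "\<lambda>x s. x \<bullet>\<^bsub>M\<^esub> component \<one> s"])
    show "abelian_group M" by (rule M.M.abelian_group_axioms)
  next
    fix y r s assume "y \<in> carrier M" "r \<in> carrier (base_ring G S D)" "s \<in> carrier S"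
    then show "y \<bullet>\<^bsub>M\<^esub> r \<bullet>\<^bsub>M\<^esub> component \<one> s = y \<bullet>\<^bsub>M\<^esub> component \<one> (r \<otimes>\<^bsub>S\<^esub> s)"
      using component_mult_left[of \<one> \<one> s r] M.rsmult_assoc[of y r "component \<one> s"] by simp
  next
    fix y s t assume "y \<in> carrier M" "s \<in> carrier S" "t \<in> carrier S"
    then show "y \<bullet>\<^bsub>M\<^esub> component \<one> (s \<oplus>\<^bsub>S\<^esub> t) = y \<bullet>\<^bsub>M\<^esub> component \<one> s \<oplus>\<^bsub>M\<^esub> y \<bullet>\<^bsub>M\<^esub> component \<one> t"
      using M.rsmult_r_distr[of y "component \<one> s" "component \<one> t"] by (simp add: component_add)
  next
    fix y z s assume "y \<in> carrier M" "z \<in> carrier M" "s \<in> carrier S"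
    then show "(y \<oplus>\<^bsub>M\<^esub> z) \<bullet>\<^bsub>M\<^esub> component \<one> s = y \<bullet>\<^bsub>M\<^esub> component \<one> s \<oplus>\<^bsub>M\<^esub> z \<bullet>\<^bsub>M\<^esub> component \<one> s"
      using M.rsmult_l_distr[of y z "component \<one> s"] by simp
  qed (use act that in blast)+
  have "x = x \<bullet>\<^bsub>M\<^esub> component \<one> \<one>\<^bsub>S\<^esub>"
    using x one_component M.rsmult_one[of x] component_homogeneous[of \<one> \<one> "\<one>\<^bsub>S\<^esub>"] by simp
  also have "\<dots> = \<zero>\<^bsub>M\<^esub>" using h[of x "\<one>\<^bsub>S\<^esub>"] x 0 h0 by simp
  finally show "x = \<zero>\<^bsub>M\<^esub>" .
next
  fix X assume "X \<in> carrier T"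
  then show "tensor_map (component \<one>) X \<in> (\<lambda>x. x \<odot> \<one>\<^bsub>S\<^esub>) ` carrier M"
  proof (induction rule: tensor_induct)
    case zero
    show ?case by (rule image_eqI[of _ _ "\<zero>\<^bsub>M\<^esub>"]) (simp_all add: proj_tensor_zero)
  next
    case (pure x s)
    \<comment> \<open>The component of \<open>s\<close> in degree \<open>e\<close> lies in
      \<open>R\<close> and can be moved across the tensor sign.\<close>
    then have "x \<odot> component \<one> s = (x \<bullet>\<^bsub>M\<^esub> component \<one> s) \<odot> \<one>\<^bsub>S\<^esub>"
      by (simp add: pure_tensor_balanced)
    moreover have "x \<bullet>\<^bsub>M\<^esub> component \<one> s \<in> carrier M"
      using pure M.rsmult_closed by simp
    ultimately show ?case using pure by (simp add: proj_tensor_pure)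
  next
    case (add X Y)
    then obtain x y where "x \<in> carrier M" "tensor_map (component \<one>) X = x \<odot> \<one>\<^bsub>S\<^esub>"
      "y \<in> carrier M" "tensor_map (component \<one>) Y = y \<odot> \<one>\<^bsub>S\<^esub>" by blast
    then show ?case
      using add.hyps by (intro image_eqI[of _ _ "x \<oplus>\<^bsub>M\<^esub> y"]) (simp_all add: proj_tensor_add pure_tensor_l_add)
  qed
next
  fix x assume "x \<in> carrier M"
  then show "tensor_map (component \<one>) (x \<odot> \<one>\<^bsub>S\<^esub>) = x \<odot> \<one>\<^bsub>S\<^esub>"
    using one_component component_homogeneous[of \<one> \<one> "\<one>\<^bsub>S\<^esub>"] by (simp add: proj_tensor_pure)
qed (simp_all add: pure_tensor_l_add)

end

section \<open>Associated primes of the tensor product\<close>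

text \<open>The right-hand side mentions neither \<open>T\<close> nor \<open>\<iota>\<close>, so the
  criterion can be compared between different tensor products.\<close>

lemma (in graded_extension) prime_graded_span_iff_core:
  assumes up: "unique_product_group G" and L: "right_submodule L (base_ring G S D) M"
  shows "prime_right_module S (T\<lparr>carrier := graded_span L\<rparr>) \<longleftrightarrow> L \<noteq> {\<zero>\<^bsub>M\<^esub>} \<and>
    (\<forall>N. right_submodule N (base_ring G S D) M \<and> N \<subseteq> L \<and> N \<noteq> {\<zero>\<^bsub>M\<^esub>} \<longrightarrow>
      core_ideal G S D (annihilator (base_ring G S D) (M\<lparr>carrier := N\<rparr>)) \<cdot>\<^bsub>S\<^esub> carrier S
      \<subseteq> core_ideal G S D (annihilator (base_ring G S D) (M\<lparr>carrier := L\<rparr>)) \<cdot>\<^bsub>S\<^esub> carrier S)"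
  unfolding prime_graded_span_iff[OF up L] using span_ann_eq[OF L] span_ann_eq by (metis (no_types))

theorem proposition3p5:
  fixes G :: "('g, 'x) monoid_scheme"
    and S :: "('s, 'y) ring_scheme"
    and D :: "'g \<Rightarrow> 's set"
    and R :: "('s, 'y) ring_scheme"
    and M :: "('s, 'm, 'z) right_module_scheme"
  assumes "unique_product_group G"
    and "strongly_graded_ring G S D"
    and "R = base_ring G S D"
    and "right_module R M"
  shows "Ass S (tensor R M S) =
           {core_ideal G S D J \<cdot>\<^bsub>S\<^esub> carrier S | J.
              \<exists>L. right_submodule L R M \<and> S_prime R S (M\<lparr>carrier := L\<rparr>) \<and>
                  J = annihilator R (M\<lparr>carrier := L\<rparr>)} \<and>
         (acc_on_ideals R \<longrightarrow>
           Ass S (tensor R M S) = {core_ideal G S D J \<cdot>\<^bsub>S\<^esub> carrier S | J. J \<in> Ass R M})"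
proof -
  let ?R = "base_ring G S D"
  let ?T = "tensor ?R M S"
  note up = assms(1)
  interpret M: right_module ?R M using assms(3,4) by simp
  interpret tensor: graded_tensor G S D M
    using assms(2) M.right_module_axioms by (rule graded_tensor.intro)
  let ?C = "\<lambda>L. core_ideal G S D (annihilator ?R (M\<lparr>carrier := L\<rparr>)) \<cdot>\<^bsub>S\<^esub> carrier S"
  \<comment> \<open>The common condition to which primeness of \<open>LS\<close> inside
    \<open>M \<otimes> S\<close> and \<open>S\<close>-primeness of \<open>L\<close> are both
    reduced.\<close>
  define core_prime where "core_prime L \<longleftrightarrow> L \<noteq> {\<zero>\<^bsub>M\<^esub>} \<and>
    (\<forall>N. right_submodule N ?R M \<and> N \<subseteq> L \<and> N \<noteq> {\<zero>\<^bsub>M\<^esub>} \<longrightarrow> ?C N \<subseteq> ?C L)" for L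
  interpret E: graded_extension G S D ?T "\<lambda>g. tensor.tensor_map (tensor.component g)" M
    "\<lambda>x. tensor.pure_tensor x \<one>\<^bsub>S\<^esub>"
    by (rule tensor.tensor_graded_extension)
  have span_prime: "prime_right_module S (?T\<lparr>carrier := E.graded_span L\<rparr>) \<longleftrightarrow> core_prime L"
    if "right_submodule L ?R M" for L
    unfolding core_prime_def using up that by (rule E.prime_graded_span_iff_core)
  \<comment> \<open>The criterion is applied with \<open>L\<close> itself as base module: the graded
    span of \<open>L\<close> is then all of \<open>L \<otimes> S\<close>, and submodules of
    \<open>L\<close> are the submodules of \<open>M\<close> inside \<open>L\<close>.\<close>
  have S_prime: "S_prime ?R S (M\<lparr>carrier := L\<rparr>) \<longleftrightarrow> core_prime L" if L: "right_submodule L ?R M" for L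
  proof -
    interpret tensor_L: graded_tensor G S D "M\<lparr>carrier := L\<rparr>"
      using assms(2) M.right_module_submodule[OF L] by (rule graded_tensor.intro)
    interpret E_L: graded_extension G S D "tensor ?R (M\<lparr>carrier := L\<rparr>) S"
      "\<lambda>g. tensor_L.tensor_map (tensor.component g)" "M\<lparr>carrier := L\<rparr>"
      "\<lambda>x. tensor_L.pure_tensor x \<one>\<^bsub>S\<^esub>"
      by (rule tensor_L.tensor_graded_extension)
    have "right_submodule N ?R (M\<lparr>carrier := L\<rparr>) \<longleftrightarrow> right_submodule N ?R M \<and> N \<subseteq> L" for N
      by (rule M.right_submodule_trans[OF L])
    moreover have "right_submodule L ?R (M\<lparr>carrier := L\<rparr>)"
      using M.right_submodule_trans[OF L] L by blast
    moreover have "E_L.graded_span L = carrier (tensor ?R (M\<lparr>carrier := L\<rparr>) S)"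
      using E_L.graded_span_carrier by simp
    ultimately show ?thesis
      using E_L.prime_graded_span_iff_core[OF up, of L]
      unfolding core_prime_def S_prime_def by simp
  qed
  have span_ann: "E.span_ann L = ?C L" if "right_submodule L ?R M" for L
    using that by (rule E.span_ann_eq)
  have Ass: "Ass S ?T = {?C L | L. right_submodule L ?R M \<and> core_prime L}"
    unfolding E.Ass_eq_span_ann[OF up]
    by (rule Collect_cong) (metis span_prime span_ann)
  have "Ass S ?T = {core_ideal G S D J \<cdot>\<^bsub>S\<^esub> carrier S | J. J \<in> Ass ?R M}" if acc: "acc_on_ideals ?R"
  proof (intro equalityI subsetI)
    fix P assume "P \<in> {core_ideal G S D J \<cdot>\<^bsub>S\<^esub> carrier S | J. J \<in> Ass ?R M}"
    then obtain L where P: "P = ?C L" and L: "right_submodule L ?R M"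
      and prime: "prime_right_module ?R (M\<lparr>carrier := L\<rparr>)"
      unfolding Ass_def by blast
    interpret L: prime_right_module ?R "M\<lparr>carrier := L\<rparr>" by (rule prime)
    \<comment> \<open>\<open>?C\<close> depends on a submodule only through its annihilator in
      \<open>R\<close>, which is constant on the nonzero submodules of a prime
      \<open>L\<close>.\<close>
    have "?C N = ?C L" if "right_submodule N ?R M" "N \<subseteq> L" "N \<noteq> {\<zero>\<^bsub>M\<^esub>}" for N
      using L.annihilator_eq[of N] M.right_submodule_trans[OF L] that by simp
    then have "core_prime L"
      using L.nonzero by (simp add: core_prime_def)
    then show "P \<in> Ass S ?T" unfolding Ass P using L by blast
  next
    fix P assume "P \<in> Ass S ?T"
    then obtain L where P: "P = ?C L" and L: "right_submodule L ?R M" "core_prime L"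
      unfolding Ass by blast
    \<comment> \<open>\<open>L\<close> itself need not be prime over \<open>R\<close>, but any prime
      \<open>N\<close> inside it yields the same associated prime: \<open>core_prime L\<close> gives
      one inclusion and \<open>N \<subseteq> L\<close> the other.\<close>
    obtain N where N: "right_submodule N ?R M" "N \<subseteq> L" "prime_right_module ?R (M\<lparr>carrier := N\<rparr>)"
      using M.acc_prime_submodule[OF acc L(1)] L(2) unfolding core_prime_def by blast
    then have "N \<noteq> {\<zero>\<^bsub>M\<^esub>}"
      using prime_right_module.nonzero[OF N(3)] by simp
    then have "?C N \<subseteq> ?C L"
      using L(2) N(1,2) unfolding core_prime_def by blast
    moreover have "?C L \<subseteq> ?C N"
      unfolding span_ann[OF L(1), symmetric] span_ann[OF N(1), symmetric]
      using N(2) by (auto simp: E.span_ann_def)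
    ultimately have "P = ?C N" unfolding P by blast
    then show "P \<in> {core_ideal G S D J \<cdot>\<^bsub>S\<^esub> carrier S | J. J \<in> Ass ?R M}"
      using N(1,3) unfolding Ass_def by blast
  qed
  moreover have "Ass S ?T = {core_ideal G S D J \<cdot>\<^bsub>S\<^esub> carrier S | J.
      \<exists>L. right_submodule L ?R M \<and> S_prime ?R S (M\<lparr>carrier := L\<rparr>) \<and>
          J = annihilator ?R (M\<lparr>carrier := L\<rparr>)}"
    unfolding Ass using S_prime by blast
  ultimately show ?thesis
    unfolding assms(3) by (intro conjI impI)
qed

end
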